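(* Let $K$ be a non-polar compact subset of $\mathbb{C}$. Then $\inf_{n\in\mathbb{N}} W_n(\mu_K)\geq 1$. The inequality is sharp: if $K=\mathbb{T}$ is the unit circle, then $d\mu_K = d\theta/(2\pi)$ and $W_n(\mu_{\mathbb{T}})=1$ for all $n\in\mathbb{N}$.
   Context: $\mathrm{Cap}(\cdot)$ denotes logarithmic capacity; a compact set is non-polar if its capacity is positive. For a non-polar compact set $K\subset\mathbb{C}$, $\mu_K$ is its equilibrium measure (a Borel probability measure), and $\mathrm{Cap}(\mathrm{supp}(\mu_K))=\mathrm{Cap}(K)$. For a Borel probability measure $\mu$ with infinite compact support in $\mathbb{C}$, $P_n(\cdot;\mu)$ is the $n$-th degree monic orthogonal polynomial for $\mu$, i.e. the monic polynomial of degree $n$ with $\|P_n(\cdot;\mu)\|_{L^2(\mathbb{C};\mu)}=\inf_{Q}\|Q\|_{L^2(\mathbb{C};\mu)}$, the infimum being over all monic complex polynomials $Q$ of degree $n$. Define $$W_n(\mu):=\frac{\|P_n(\cdot;\mu)\|_{L^2(\mathbb{C};\mu)}}{\mathrm{Cap}(\mathrm{supp}(\mu))^n},$$ so that $W_n(\mu_K)=\|P_n(\cdot;\mu_K)\|_{L^2(\mathbb{C};\mu_K)}/\mathrm{Cap}(K)^n$. *)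

theory Defs
  imports "HOL-Probability.Probability" "HOL-Computational_Algebra.Polynomial"
begin

section \<open>Logarithmic capacity and equilibrium measures\<close>

text \<open>The case distinction is needed because \<^term>\<open>ln 0 = (0::real)\<close>.\<close>

definition log_kernel :: "complex \<Rightarrow> complex \<Rightarrow> ereal" where
  "log_kernel z w = (if z = w then \<infinity> else ereal (- ln (cmod (z - w))))"

text \<open>
  The double integral of \<open>log (1 / \<bar>z - w\<bar>)\<close>, as positive part minus negative part
  (\<^const>\<open>e2ennreal\<close> truncates negative numbers to 0).
  The negative part is finite for probability measures on compact sets, the only case used.
\<close>

definition log_energy :: "complex measure \<Rightarrow> ereal" where
  "log_energy \<mu> =
     enn2ereal (\<integral>\<^sup>+z. \<integral>\<^sup>+w. e2ennreal (log_kernel z w) \<partial>\<mu> \<partial>\<mu>)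
   - enn2ereal (\<integral>\<^sup>+z. \<integral>\<^sup>+w. e2ennreal (- log_kernel z w) \<partial>\<mu> \<partial>\<mu>)"

definition prob_measures_on :: "complex set \<Rightarrow> complex measure set" where
  "prob_measures_on K = {\<mu>. prob_space \<mu> \<and> sets \<mu> = sets borel \<and> emeasure \<mu> K = 1}"

definition robin_constant :: "complex set \<Rightarrow> ereal" where
  "robin_constant K = (INF \<mu>\<in>prob_measures_on K. log_energy \<mu>)"

text \<open>For compact \<open>K\<close>: \<open>exp (- V)\<close>, where \<open>V\<close> is the Robin constant and \<open>exp (- \<infinity>)\<close> is read as 0.\<close>

definition capacity :: "complex set \<Rightarrow> real" where
  "capacity K =
     (if robin_constant K = \<infinity> then 0 else exp (- real_of_ereal (robin_constant K)))"

definition non_polar :: "complex set \<Rightarrow> bool" where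
  "non_polar K \<longleftrightarrow> capacity K > 0"

text \<open>A predicate rather than a function; for non-polar compact \<open>K\<close> there is exactly one such \<open>\<mu>\<close>.\<close>

definition is_equilibrium_measure :: "complex set \<Rightarrow> complex measure \<Rightarrow> bool" where
  "is_equilibrium_measure K \<mu> \<longleftrightarrow>
     \<mu> \<in> prob_measures_on K \<and> log_energy \<mu> = robin_constant K"


section \<open>Orthogonal polynomials and Widom factors\<close>

definition msupport :: "complex measure \<Rightarrow> complex set" where
  "msupport \<mu> = {z. \<forall>U. open U \<longrightarrow> z \<in> U \<longrightarrow> emeasure \<mu> U > 0}"

definition L2_poly_norm :: "complex measure \<Rightarrow> complex poly \<Rightarrow> real" where
  "L2_poly_norm \<mu> Q = sqrt (LINT z|\<mu>. (cmod (poly Q z))\<^sup>2)"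

definition monic_polys :: "nat \<Rightarrow> complex poly set" where
  "monic_polys n = {Q. degree Q = n \<and> lead_coeff Q = 1}"

definition monic_orth_poly :: "nat \<Rightarrow> complex measure \<Rightarrow> complex poly" where
  "monic_orth_poly n \<mu> =
     (THE P. P \<in> monic_polys n \<and> L2_poly_norm \<mu> P = (INF Q\<in>monic_polys n. L2_poly_norm \<mu> Q))"

definition widom_factor :: "nat \<Rightarrow> complex measure \<Rightarrow> real" where
  "widom_factor n \<mu> = L2_poly_norm \<mu> (monic_orth_poly n \<mu>) / capacity (msupport \<mu>) ^ n"


section \<open>The unit circle\<close>

abbreviation unit_circle :: "complex set" where
  "unit_circle \<equiv> sphere 0 1"

text \<open>\<open>d\<theta> / (2 \<pi>)\<close>: the image under \<open>\<theta> \<mapsto> exp (\<i> \<theta>)\<close> of the uniform distribution on \<open>[0, 2 \<pi>]\<close>.\<close>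

definition arc_measure :: "complex measure" where
  "arc_measure = distr (uniform_measure lborel {0..2 * pi}) borel cis"

end

theory Submission
  imports Defs "HOL-Computational_Algebra.Fundamental_Theorem_Algebra"
begin

text \<open>
  Write \<open>p(z) = \<integral> ln \<bar>z - w\<bar> d\<mu>(w)\<close> for the logarithmic potential of the equilibrium measure \<open>\<mu>\<close> of
  \<open>K\<close>, and \<open>V\<close> for its energy, so that \<open>Cap K = exp (- V)\<close>. The lower bound rests on Frostman's
  inequality \<open>p \<ge> - V\<close> on the whole plane (\<open>frostman\<close>). For a monic polynomial \<open>P\<close> with roots
  \<open>a\<^sub>1, \<dots>, a\<^sub>n\<close>, Jensen's inequality then gives
  \<open>\<integral> \<bar>P\<bar>\<^sup>2 d\<mu> \<ge> exp (2 \<integral> ln \<bar>P\<bar> d\<mu>) = exp (2 (p(a\<^sub>1) + \<dots> + p(a\<^sub>n))) \<ge> exp (- 2 n V) = Cap(K)\<^sup>2\<^sup>n\<close>.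
  The support of \<open>\<mu>\<close> has the same capacity as \<open>K\<close>, because \<open>\<mu>\<close> competes in both minimization problems.

  Frostman's inequality has two parts. If \<open>p > - V\<close> held on a set of positive measure, shifting some
  mass of \<open>\<mu>\<close> to it would lower the energy; hence \<open>p = - V\<close> almost everywhere, and
  semicontinuity gives \<open>p \<ge> - V\<close> on the support. Outside the support \<open>p\<close> is harmonic, tends to infinity
  at infinity, and has lower limits at least \<open>- V\<close> at the support, so a minimum principle applies
  (\<open>log_potential_minimum_principle\<close>).

  For the unit circle, let \<open>m\<^sub>n = \<integral> z\<^sup>n d\<nu>\<close> be the moments of a measure \<open>\<nu>\<close> on the circle. Expanding
  \<open>- ln \<bar>z - r w\<bar>\<close> for \<open>r < 1\<close> into a power series shows that its double integral is the sum of
  \<open>r\<^sup>n \<bar>m\<^sub>n\<bar>\<^sup>2 / n\<close> over \<open>n \<ge> 1\<close>. As \<open>r\<close> tends to 1, the energy of \<open>\<nu>\<close> is at least \<open>\<bar>m\<^sub>n\<bar>\<^sup>2 / n\<close> for each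
  \<open>n \<ge> 1\<close> (\<open>log_energy_ge_moment\<close>), and at most 0 if all these moments vanish. So the
  Robin constant is 0 and is attained exactly by the measures whose moments vanish, that is, only by
  normalized arc length (\<open>measure_eqI_moments\<close>). Testing with \<open>z\<^sup>n\<close>, which has \<open>L\<^sup>2\<close>-norm 1, bounds its
  Widom factors by 1 from above.
\<close>

section \<open>Probability measures on compact sets and their supports\<close>

lemma prob_measures_onD:
  assumes "\<mu> \<in> prob_measures_on K"
  shows "prob_space \<mu>" "sets \<mu> = sets borel" "emeasure \<mu> K = 1" "space \<mu> = UNIV"
  using assms sets_eq_imp_space_eq[of \<mu> borel] by (auto simp: prob_measures_on_def)

lemma prob_measures_on_AE:
  assumes "\<mu> \<in> prob_measures_on K" "K \<in> sets borel"
  shows "AE z in \<mu>. z \<in> K"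
proof -
  interpret prob_space \<mu> using assms prob_measures_onD by auto
  have "prob K = 1"
    using prob_measures_onD(3)[OF assms(1)] by (simp add: measure_def)
  then show ?thesis
    using prob_eq_1[of K] assms(2) prob_measures_onD(2)[OF assms(1)] by simp
qed

lemma prob_measures_onI_AE:
  assumes "prob_space \<mu>" "sets \<mu> = sets borel" "AE z in \<mu>. z \<in> K" "K \<in> sets borel"
  shows "\<mu> \<in> prob_measures_on K"
proof -
  interpret prob_space \<mu> by fact
  show ?thesis
    using prob_eq_1[of K] assms by (simp add: prob_measures_on_def emeasure_eq_measure)
qed

lemma integrable_prob_measures_on:
  fixes f :: "complex \<Rightarrow> 'b::{banach, second_countable_topology}"
  assumes "\<mu> \<in> prob_measures_on K" "compact K" "f \<in> borel_measurable borel" "continuous_on K f"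
  shows "integrable \<mu> f"
proof -
  interpret prob_space \<mu> using assms prob_measures_onD by auto
  have "compact (f ` K)"
    using assms compact_continuous_image by blast
  then obtain B where B: "\<And>z. z \<in> K \<Longrightarrow> norm (f z) \<le> B"
    by (meson bounded_iff compact_imp_bounded imageI)
  show ?thesis
  proof (rule integrable_const_bound)
    show "AE z in \<mu>. norm (f z) \<le> B"
      using prob_measures_on_AE[OF assms(1)] assms(2) B by (auto simp: borel_compact)
    show "f \<in> borel_measurable \<mu>"
      using assms(3) measurable_cong_sets[OF prob_measures_onD(2)[OF assms(1)] refl] by blast
  qed
qed


lemma closed_msupport: "closed (msupport \<mu>)"
proof -
  have "open (- msupport \<mu>)"
    unfolding open_subopen[of "- msupport \<mu>"] by (auto simp: msupport_def)
  then show ?thesis by (simp add: closed_def)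
qed

text \<open>By the Lindelof property, the complement of the support is a countable union of null sets.\<close>

lemma AE_in_msupport:
  assumes "sets \<mu> = sets borel"
  shows "AE z in \<mu>. z \<in> msupport \<mu>"
proof -
  define F where "F = {U. open U \<and> emeasure \<mu> U = 0}"
  have "\<And>S. S \<in> F \<Longrightarrow> open S" by (auto simp: F_def)
  then obtain F' where F': "F' \<subseteq> F" "countable F'" "\<Union>F' = \<Union>F"
    using Lindelof[of F] by blast
  have "\<Union>F = - msupport \<mu>"
    by (auto simp: F_def msupport_def zero_less_iff_neq_zero)
  moreover have "AE z in \<mu>. \<forall>U\<in>F'. z \<notin> U"
  proof (subst AE_ball_countable[OF F'(2)], intro ballI)
    fix U assume "U \<in> F'"
    then show "AE z in \<mu>. z \<notin> U"
      using F' assms by (intro AE_not_in) (auto simp: F_def null_sets_def)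
  qed
  ultimately show ?thesis
    using F'(3) by (auto elim!: eventually_mono)
qed

lemma msupport_subset:
  assumes "\<mu> \<in> prob_measures_on C" "closed C"
  shows "msupport \<mu> \<subseteq> C"
proof
  interpret prob_space \<mu> using assms prob_measures_onD by auto
  fix z assume z: "z \<in> msupport \<mu>"
  show "z \<in> C"
  proof (rule ccontr)
    assume "z \<notin> C"
    then have "emeasure \<mu> (- C) > 0"
      using z assms(2) by (auto simp: msupport_def open_Compl)
    moreover have "emeasure \<mu> (- C) = 0"
      using emeasure_compl[of C \<mu>] emeasure_space_1 assms(2) prob_measures_onD[OF assms(1)]
      by (simp add: Compl_eq_Diff_UNIV)
    ultimately show False by simp
  qed
qed

lemma compact_msupport:
  assumes "\<mu> \<in> prob_measures_on K" "compact K"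
  shows "compact (msupport \<mu>)"
  using msupport_subset[OF assms(1)] closed_msupport[of \<mu>] assms(2)
  by (metis compact_imp_closed compact_Int_closed inf.absorb2)

lemma prob_measures_on_msupport:
  assumes "\<mu> \<in> prob_measures_on K"
  shows "\<mu> \<in> prob_measures_on (msupport \<mu>)"
  using prob_measures_onD[OF assms] closed_msupport[of \<mu>]
  by (intro prob_measures_onI_AE AE_in_msupport) auto

lemma prob_measures_on_mono:
  assumes "K \<subseteq> L" "L \<in> sets borel"
  shows "prob_measures_on K \<subseteq> prob_measures_on L"
proof
  fix \<mu> assume \<mu>: "\<mu> \<in> prob_measures_on K"
  interpret prob_space \<mu> using \<mu> prob_measures_onD by auto
  have "1 \<le> emeasure \<mu> L"
    using emeasure_mono[of K L \<mu>] assms \<mu> by (auto simp: prob_measures_on_def)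
  then have "emeasure \<mu> L = 1"
    using emeasure_le_1[of L] by (rule antisym[rotated])
  then show "\<mu> \<in> prob_measures_on L"
    using \<mu> by (simp add: prob_measures_on_def)
qed

lemma robin_constant_antimono:
  assumes "K \<subseteq> L" "L \<in> sets borel"
  shows "robin_constant L \<le> robin_constant K"
  unfolding robin_constant_def by (rule INF_superset_mono[OF prob_measures_on_mono[OF assms]]) simp

lemma robin_constant_msupport:
  assumes "is_equilibrium_measure K \<mu>" "compact K"
  shows "robin_constant (msupport \<mu>) = robin_constant K"
proof (rule antisym)
  have \<mu>: "\<mu> \<in> prob_measures_on K" "log_energy \<mu> = robin_constant K"
    using assms(1) by (auto simp: is_equilibrium_measure_def)
  show "robin_constant (msupport \<mu>) \<le> robin_constant K"
    unfolding \<mu>(2)[symmetric] robin_constant_def[of "msupport \<mu>"]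
    by (intro INF_lower prob_measures_on_msupport[OF \<mu>(1)])
  show "robin_constant K \<le> robin_constant (msupport \<mu>)"
    using assms(2) \<mu>(1)
    by (intro robin_constant_antimono msupport_subset) (auto simp: borel_compact compact_imp_closed)
qed

section \<open>Nonnegative form of the energy\<close>

text \<open>
  The positive part of \<open>ln (D / \<bar>z - w\<bar>)\<close>, which is infinite on the diagonal. For \<open>D\<close> at least the
  diameter of the underlying set nothing is cut off, and energies become integrals of nonnegative functions.
\<close>

definition shifted_kernel :: "real \<Rightarrow> complex \<Rightarrow> complex \<Rightarrow> ennreal" where
  "shifted_kernel D z w = e2ennreal (ereal (ln D) + log_kernel z w)"

text \<open>At points of that set, for \<open>\<mu>\<close> free of atoms, this is \<open>ln D - \<integral> ln \<bar>z - w\<bar> d\<mu>(w)\<close>.\<close>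

definition shifted_potential :: "real \<Rightarrow> complex measure \<Rightarrow> complex \<Rightarrow> ennreal" where
  "shifted_potential D \<mu> z = (\<integral>\<^sup>+w. shifted_kernel D z w \<partial>\<mu>)"

lemma shifted_kernel_commute: "shifted_kernel D z w = shifted_kernel D w z"
  by (simp add: shifted_kernel_def log_kernel_def norm_minus_commute)

lemma shifted_kernel_eq:
  "shifted_kernel D z w = (if z = w then \<infinity> else ennreal (ln D - ln (cmod (z - w))))"
  by (simp add: shifted_kernel_def log_kernel_def e2ennreal_ereal e2ennreal_infty)

lemma measurable_log_kernel:
  "(\<lambda>x. log_kernel (fst x) (snd x)) \<in> borel_measurable (borel \<Otimes>\<^sub>M borel)"
  unfolding log_kernel_def by measurable

lemma measurable_shifted_kernel:
  assumes "sets \<mu> = sets borel" "sets \<nu> = sets borel"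
  shows "case_prod (shifted_kernel D) \<in> borel_measurable (\<mu> \<Otimes>\<^sub>M \<nu>)"
proof -
  have "case_prod (shifted_kernel D) \<in> borel_measurable (borel \<Otimes>\<^sub>M borel)"
    unfolding shifted_kernel_def case_prod_beta using measurable_log_kernel by measurable
  then show ?thesis
    using measurable_cong_sets[OF sets_pair_measure_cong[OF assms] refl] by blast
qed

lemma measurable_shifted_kernel_Pair [measurable]:
  "shifted_kernel D z \<in> borel_measurable borel"
  using measurable_compose_Pair1[OF _ measurable_shifted_kernel[OF refl refl], of z D] by simp

lemma measurable_shifted_potential:
  assumes "sets \<mu> = sets borel" "prob_space \<mu>"
  shows "shifted_potential D \<mu> \<in> borel_measurable borel"
proof -
  interpret prob_space \<mu> by fact
  show ?thesis
    unfolding shifted_potential_def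
    by (rule borel_measurable_nn_integral[OF measurable_shifted_kernel]) (use assms in auto)
qed

lemma log_energy_shifted:
  assumes \<mu>: "\<mu> \<in> prob_measures_on K" and K: "compact K"
    and D: "\<And>z w. z \<in> K \<Longrightarrow> w \<in> K \<Longrightarrow> dist z w \<le> D" "D \<ge> 1"
  shows "log_energy \<mu> + ereal (ln D) = enn2ereal (\<integral>\<^sup>+z. shifted_potential D \<mu> z \<partial>\<mu>)"
proof -
  note \<mu>' = prob_measures_onD[OF \<mu>]
  interpret prob_space \<mu> using \<mu>' by auto
  have [measurable_cong, simp]: "sets \<mu> = sets borel" by (fact \<mu>')
  have AE: "AE z in \<mu>. z \<in> K"
    using prob_measures_on_AE[OF \<mu>] K by (simp add: borel_compact)
  have meas_log_kernel: "(\<lambda>x. log_kernel (fst x) (snd x)) \<in> borel_measurable (borel \<Otimes>\<^sub>M \<mu>)"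
    using measurable_log_kernel measurable_cong_sets[OF sets_pair_measure_cong[OF refl \<mu>'(2)] refl]
    by blast
  have [measurable]: "(\<lambda>x. e2ennreal (log_kernel (fst x) (snd x))) \<in> borel_measurable (borel \<Otimes>\<^sub>M \<mu>)"
     "(\<lambda>x. e2ennreal (- log_kernel (fst x) (snd x))) \<in> borel_measurable (borel \<Otimes>\<^sub>M \<mu>)"
    using meas_log_kernel by measurable
  have [measurable]: "(\<lambda>w. e2ennreal (log_kernel z w)) \<in> borel_measurable \<mu>"
     "(\<lambda>w. e2ennreal (- log_kernel z w)) \<in> borel_measurable \<mu>" for z
    using measurable_compose_Pair1[of z borel "\<lambda>x. e2ennreal (log_kernel (fst x) (snd x))" \<mu> borel]
      measurable_compose_Pair1[of z borel "\<lambda>x. e2ennreal (- log_kernel (fst x) (snd x))" \<mu> borel]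
    by auto
  define Pos where "Pos z = (\<integral>\<^sup>+w. e2ennreal (log_kernel z w) \<partial>\<mu>)" for z
  define Neg where "Neg z = (\<integral>\<^sup>+w. e2ennreal (- log_kernel z w) \<partial>\<mu>)" for z
  have [measurable]: "Pos \<in> borel_measurable borel" "Neg \<in> borel_measurable borel"
    unfolding Pos_def Neg_def
    by (rule borel_measurable_nn_integral; simp add: case_prod_beta; measurable)+
  note [measurable] = measurable_shifted_potential[OF \<mu>'(2,1), of D]
  have lnD: "ln D \<ge> 0" using D by simp
  have pw: "e2ennreal (log_kernel z w) + ennreal (ln D) = shifted_kernel D z w + e2ennreal (- log_kernel z w)"
    and pw_neg: "e2ennreal (- log_kernel z w) \<le> ennreal (ln D)" if "z \<in> K" "w \<in> K" for z w
  proof -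
    have le: "z \<noteq> w \<Longrightarrow> ln (cmod (z - w)) \<le> ln D"
      using D(1)[OF that] D(2) by (auto simp: dist_norm)
    show "e2ennreal (log_kernel z w) + ennreal (ln D) = shifted_kernel D z w + e2ennreal (- log_kernel z w)"
      using le lnD
      by (cases "ln (cmod (z - w)) \<ge> 0")
         (auto simp: shifted_kernel_eq log_kernel_def e2ennreal_infty e2ennreal_ereal
           ennreal_neg simp flip: ennreal_plus)
    show "e2ennreal (- log_kernel z w) \<le> ennreal (ln D)"
      using le by (auto simp: log_kernel_def e2ennreal_ereal e2ennreal_neg intro: ennreal_leI)
  qed
  have eq: "Pos z + ennreal (ln D) = shifted_potential D \<mu> z + Neg z" if "z \<in> K" for z
  proof -
    have "Pos z + ennreal (ln D) = (\<integral>\<^sup>+w. e2ennreal (log_kernel z w) + ennreal (ln D) \<partial>\<mu>)"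
      unfolding Pos_def by (subst nn_integral_add) (auto simp: emeasure_space_1)
    also have "\<dots> = (\<integral>\<^sup>+w. shifted_kernel D z w + e2ennreal (- log_kernel z w) \<partial>\<mu>)"
      using AE by (intro nn_integral_cong_AE) (auto elim!: eventually_mono simp: pw[OF that])
    also have "\<dots> = shifted_potential D \<mu> z + Neg z"
      unfolding Neg_def shifted_potential_def by (subst nn_integral_add) auto
    finally show ?thesis .
  qed
  have Neg: "Neg z \<le> ennreal (ln D)" if "z \<in> K" for z
  proof -
    have "Neg z \<le> (\<integral>\<^sup>+w. ennreal (ln D) \<partial>\<mu>)"
      unfolding Neg_def
      using AE by (intro nn_integral_mono_AE) (auto elim!: eventually_mono simp: pw_neg[OF that])
    then show ?thesis by (simp add: emeasure_space_1)
  qed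
  have total: "(\<integral>\<^sup>+z. Pos z \<partial>\<mu>) + ennreal (ln D)
      = (\<integral>\<^sup>+z. shifted_potential D \<mu> z \<partial>\<mu>) + (\<integral>\<^sup>+z. Neg z \<partial>\<mu>)"
  proof -
    have "(\<integral>\<^sup>+z. Pos z \<partial>\<mu>) + ennreal (ln D) = (\<integral>\<^sup>+z. Pos z + ennreal (ln D) \<partial>\<mu>)"
      by (subst nn_integral_add) (auto simp: emeasure_space_1)
    also have "\<dots> = (\<integral>\<^sup>+z. shifted_potential D \<mu> z + Neg z \<partial>\<mu>)"
      using AE by (intro nn_integral_cong_AE) (auto elim!: eventually_mono simp: eq)
    also have "\<dots> = (\<integral>\<^sup>+z. shifted_potential D \<mu> z \<partial>\<mu>) + (\<integral>\<^sup>+z. Neg z \<partial>\<mu>)"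
      by (subst nn_integral_add) auto
    finally show ?thesis .
  qed
  have "(\<integral>\<^sup>+z. Neg z \<partial>\<mu>) \<le> (\<integral>\<^sup>+z. ennreal (ln D) \<partial>\<mu>)"
    using AE by (intro nn_integral_mono_AE) (auto elim!: eventually_mono simp: Neg)
  then have "(\<integral>\<^sup>+z. Neg z \<partial>\<mu>) \<le> ennreal (ln D)"
    by (simp add: emeasure_space_1)
  then have "(\<integral>\<^sup>+z. Neg z \<partial>\<mu>) < \<infinity>"
    by (simp add: order_le_less_trans)
  then obtain b where b: "(\<integral>\<^sup>+z. Neg z \<partial>\<mu>) = ennreal b" "b \<ge> 0"
    by (cases "\<integral>\<^sup>+z. Neg z \<partial>\<mu>") auto
  have "enn2ereal (\<integral>\<^sup>+z. Pos z \<partial>\<mu>) + ereal (ln D)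
      = enn2ereal (\<integral>\<^sup>+z. shifted_potential D \<mu> z \<partial>\<mu>) + ereal b"
    using arg_cong[OF total, of enn2ereal] b lnD by (simp add: plus_ennreal.rep_eq enn2ereal_ennreal)
  then show ?thesis
    unfolding log_energy_def Pos_def[symmetric] Neg_def[symmetric]
    using b by (cases "enn2ereal (\<integral>\<^sup>+z. Pos z \<partial>\<mu>)";
        cases "enn2ereal (\<integral>\<^sup>+z. shifted_potential D \<mu> z \<partial>\<mu>)") (auto simp: enn2ereal_ennreal)
qed

section \<open>Minimality of the energy forces a constant potential\<close>

lemma no_atoms_if_finite_energy:
  assumes \<mu>: "\<mu> \<in> prob_measures_on K" and fin: "(\<integral>\<^sup>+z. shifted_potential D \<mu> z \<partial>\<mu>) < \<infinity>"
  shows "emeasure \<mu> {a} = 0"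
proof (rule ccontr)
  note \<mu>' = prob_measures_onD[OF \<mu>]
  interpret prob_space \<mu> using \<mu>' by auto
  have [measurable_cong, simp]: "sets \<mu> = sets borel" by (fact \<mu>')
  assume pos: "emeasure \<mu> {a} \<noteq> 0"
  have "(\<integral>\<^sup>+w. \<infinity> * indicator {a} w \<partial>\<mu>) \<le> shifted_potential D \<mu> a"
    unfolding shifted_potential_def
    by (intro nn_integral_mono) (auto simp: shifted_kernel_eq indicator_def)
  then have "shifted_potential D \<mu> a = \<infinity>"
    using pos by (subst (asm) nn_integral_cmult_indicator) (auto simp: ennreal_top_mult top_unique)
  then have "(\<integral>\<^sup>+w. \<infinity> * indicator {a} w \<partial>\<mu>) \<le> (\<integral>\<^sup>+z. shifted_potential D \<mu> z \<partial>\<mu>)"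
    by (intro nn_integral_mono) (auto simp: indicator_def)
  then show False
    using pos fin by (subst (asm) nn_integral_cmult_indicator) (auto simp: ennreal_top_mult top_unique)
qed

text \<open>Lower semicontinuity of the potential, by Fatou's lemma.\<close>

lemma closed_shifted_potential_le:
  assumes \<mu>: "\<mu> \<in> prob_measures_on K" and atoms: "\<And>a. emeasure \<mu> {a} = 0"
  shows "closed {z. shifted_potential D \<mu> z \<le> c}"
  unfolding closed_sequential_limits
proof (intro allI impI, elim conjE)
  note \<mu>' = prob_measures_onD[OF \<mu>]
  interpret prob_space \<mu> using \<mu>' by auto
  have [measurable_cong, simp]: "sets \<mu> = sets borel" by (fact \<mu>')
  fix X z assume X: "\<forall>n::nat. X n \<in> {z. shifted_potential D \<mu> z \<le> c}" "X \<longlonglongrightarrow> z"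
  have ne: "AE w in \<mu>. w \<noteq> z"
    using atoms[of z] by (intro AE_I[of _ _ "{z}"]) auto
  have "shifted_potential D \<mu> z \<le> (\<integral>\<^sup>+w. liminf (\<lambda>n. shifted_kernel D (X n) w) \<partial>\<mu>)"
    unfolding shifted_potential_def
  proof (intro nn_integral_mono_AE)
    have "shifted_kernel D z w \<le> liminf (\<lambda>n. shifted_kernel D (X n) w)" if "w \<noteq> z" for w
    proof -
      have "(\<lambda>n. ennreal (ln D - ln (cmod (X n - w)))) \<longlonglongrightarrow> ennreal (ln D - ln (cmod (z - w)))"
        using that by (intro tendsto_ennrealI tendsto_intros X) auto
      moreover have "eventually (\<lambda>n. ennreal (ln D - ln (cmod (X n - w))) = shifted_kernel D (X n) w) sequentially"
        using tendsto_imp_eventually_ne[OF X(2) that[symmetric]]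
        by eventually_elim (simp add: shifted_kernel_eq)
      ultimately have "(\<lambda>n. shifted_kernel D (X n) w) \<longlonglongrightarrow> ennreal (ln D - ln (cmod (z - w)))"
        by (rule Lim_transform_eventually)
      then have "liminf (\<lambda>n. shifted_kernel D (X n) w) = ennreal (ln D - ln (cmod (z - w)))"
        by (rule lim_imp_Liminf[OF sequentially_bot])
      then show ?thesis
        using that by (simp add: shifted_kernel_eq[of D z w])
    qed
    then show "AE w in \<mu>. shifted_kernel D z w \<le> liminf (\<lambda>n. shifted_kernel D (X n) w)"
      using ne by auto
  qed
  also have "\<dots> \<le> liminf (\<lambda>n. shifted_potential D \<mu> (X n))"
    unfolding shifted_potential_def by (rule nn_integral_liminf) simp
  also have "\<dots> \<le> c"
    using X(1) by (intro Liminf_le) auto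
  finally show "z \<in> {z. shifted_potential D \<mu> z \<le> c}" by simp
qed

text \<open>
  The variational step. If the potential were at most \<open>c\<close>, below the minimal energy \<open>P\<close>, on a set \<open>A\<close> of positive
  measure \<open>m\<close>, then the competitor with density \<open>1 - t + (t / m) 1\<^sub>A\<close> would have energy at most
  \<open>(1 - t)\<^sup>2 P + 2 t (1 - t) c + O(t\<^sup>2)\<close>, which is less than \<open>P\<close> for small \<open>t > 0\<close>.
\<close>

lemma energy_minimizer_sublevel_null:
  assumes \<mu>: "\<mu> \<in> prob_measures_on K" and K: "compact K"
    and fin: "(\<integral>\<^sup>+z. shifted_potential D \<mu> z \<partial>\<mu>) = ennreal P" "0 \<le> P"
    and min: "\<And>\<nu>. \<nu> \<in> prob_measures_on K \<Longrightarrow> ennreal P \<le> (\<integral>\<^sup>+z. shifted_potential D \<nu> z \<partial>\<nu>)"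
    and c: "0 \<le> c" "c < P"
  shows "emeasure \<mu> {z. shifted_potential D \<mu> z \<le> ennreal c} = 0"
proof (rule ccontr)
  note \<mu>' = prob_measures_onD[OF \<mu>]
  interpret prob_space \<mu> using \<mu>' by auto
  have [measurable_cong, simp]: "sets \<mu> = sets borel" by (fact \<mu>')
  note [measurable] = measurable_shifted_potential[OF \<mu>'(2,1), of D]
  have [measurable]: "K \<in> sets borel" using K by (simp add: borel_compact)
  define A where "A = {z. shifted_potential D \<mu> z \<le> ennreal c}"
  have A [measurable]: "A \<in> sets borel" unfolding A_def by measurable
  assume "emeasure \<mu> {z. shifted_potential D \<mu> z \<le> ennreal c} \<noteq> 0"
  then have mpos: "prob A > 0"
    by (auto simp: A_def emeasure_eq_measure zero_less_measure_iff)
  define m where "m = prob A"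
  have m: "0 < m" "emeasure \<mu> A = ennreal m" using mpos by (auto simp: m_def emeasure_eq_measure)
  \<comment> \<open>The potential of the restriction of \<open>\<mu>\<close> to \<open>A\<close>, not normalized.\<close>
  define q where "q z = (\<integral>\<^sup>+w. shifted_kernel D z w * indicator A w \<partial>\<mu>)" for z
  have kernel_meas: "case_prod (shifted_kernel D) \<in> borel_measurable (borel \<Otimes>\<^sub>M \<mu>)"
    "case_prod (shifted_kernel D) \<in> borel_measurable (\<mu> \<Otimes>\<^sub>M \<mu>)"
    by (rule measurable_shifted_kernel; simp)+
  have [measurable]: "(\<lambda>(z, w). shifted_kernel D z w * indicator A w) \<in> borel_measurable (borel \<Otimes>\<^sub>M \<mu>)"
    using kernel_meas(1) unfolding case_prod_beta by measurable
  have q_meas [measurable]: "q \<in> borel_measurable borel"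
    unfolding q_def by (rule borel_measurable_nn_integral) simp
  have [measurable]: "(\<lambda>(z, w). shifted_kernel D z w * indicator A w) \<in> borel_measurable (\<mu> \<Otimes>\<^sub>M \<mu>)"
    using kernel_meas(2) unfolding case_prod_beta by measurable
  have potA: "(\<integral>\<^sup>+z. shifted_potential D \<mu> z * indicator A z \<partial>\<mu>) \<le> ennreal (c * m)"
  proof -
    have "(\<integral>\<^sup>+z. shifted_potential D \<mu> z * indicator A z \<partial>\<mu>) \<le> (\<integral>\<^sup>+z. ennreal c * indicator A z \<partial>\<mu>)"
      by (intro nn_integral_mono) (auto simp: A_def indicator_def)
    then show ?thesis
      using c m by (simp add: nn_integral_cmult_indicator ennreal_mult)
  qed
  have q_le: "q z \<le> shifted_potential D \<mu> z" for z
    unfolding q_def shifted_potential_def by (intro nn_integral_mono) (auto simp: indicator_def)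
  have qA: "(\<integral>\<^sup>+z. q z * indicator A z \<partial>\<mu>) \<le> ennreal P"
    unfolding fin(1)[symmetric]
    by (intro nn_integral_mono) (auto simp: indicator_def intro: q_le)
  have intq: "(\<integral>\<^sup>+z. q z \<partial>\<mu>) \<le> ennreal (c * m)"
  proof -
    interpret pair_sigma_finite \<mu> \<mu> ..
    have "(\<integral>\<^sup>+z. q z \<partial>\<mu>) = (\<integral>\<^sup>+w. (\<integral>\<^sup>+z. shifted_kernel D z w * indicator A w \<partial>\<mu>) \<partial>\<mu>)"
      unfolding q_def by (rule Fubini') simp
    also have "\<dots> = (\<integral>\<^sup>+w. shifted_potential D \<mu> w * indicator A w \<partial>\<mu>)"
      unfolding shifted_potential_def
      by (intro nn_integral_cong, subst nn_integral_multc[symmetric]) (simp_all add: shifted_kernel_commute)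
    finally show ?thesis using potA by simp
  qed
  have key: "P \<le> (1 - t)\<^sup>2 * P + 2 * ((1 - t) * t * c) + (t / m)\<^sup>2 * P" if t: "0 \<le> t" "t \<le> 1" for t
  proof -
    define f where "f w = ennreal (1 - t) + ennreal (t / m) * indicator A w" for w
    have [measurable]: "f \<in> borel_measurable borel" unfolding f_def by measurable
    define \<nu> where "\<nu> = density \<mu> f"
    have sets\<nu>: "sets \<nu> = sets borel" by (simp add: \<nu>_def)
    have total: "(\<integral>\<^sup>+w. f w \<partial>\<mu>) = 1"
    proof -
      have "(\<integral>\<^sup>+w. f w \<partial>\<mu>) = ennreal (1 - t) + ennreal (t / m) * ennreal m"
        unfolding f_def using m
        by (subst nn_integral_add) (auto simp: nn_integral_cmult_indicator emeasure_space_1)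
      also have "\<dots> = ennreal ((1 - t) + t / m * m)"
        using t m by (simp add: ennreal_mult'[symmetric] del: times_divide_eq_left flip: ennreal_plus)
      finally show ?thesis using m by simp
    qed
    have \<nu>: "\<nu> \<in> prob_measures_on K"
    proof (rule prob_measures_onI_AE)
      show "prob_space \<nu>"
        using total by (intro prob_spaceI) (simp add: \<nu>_def emeasure_density \<mu>' nn_integral_set_ennreal[symmetric])
      show "AE z in \<nu>. z \<in> K"
        using prob_measures_on_AE[OF \<mu>] unfolding \<nu>_def by (subst AE_density) auto
    qed (use sets\<nu> in auto)
    have pot: "shifted_potential D \<nu> z = ennreal (1 - t) * shifted_potential D \<mu> z + ennreal (t / m) * q z" for z
    proof -
      have "shifted_potential D \<nu> z = (\<integral>\<^sup>+w. f w * shifted_kernel D z w \<partial>\<mu>)"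
        unfolding shifted_potential_def \<nu>_def by (subst nn_integral_density) auto
      also have "\<dots> = (\<integral>\<^sup>+w. ennreal (1 - t) * shifted_kernel D z w
           + ennreal (t / m) * (shifted_kernel D z w * indicator A w) \<partial>\<mu>)"
        by (intro nn_integral_cong) (auto simp: f_def algebra_simps)
      also have "\<dots> = ennreal (1 - t) * shifted_potential D \<mu> z + ennreal (t / m) * q z"
        unfolding q_def shifted_potential_def
        by (subst nn_integral_add) (auto simp: nn_integral_cmult)
      finally show ?thesis .
    qed
    have "(\<integral>\<^sup>+z. shifted_potential D \<nu> z \<partial>\<nu>) = (\<integral>\<^sup>+z. f z * shifted_potential D \<nu> z \<partial>\<mu>)"
      unfolding pot unfolding \<nu>_def by (subst nn_integral_density) auto
    also have "\<dots> = (\<integral>\<^sup>+z. ennreal (1 - t) * (ennreal (1 - t) * shifted_potential D \<mu> z)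
         + (ennreal (1 - t) * (ennreal (t / m) * q z)
         + (ennreal (1 - t) * (ennreal (t / m) * (shifted_potential D \<mu> z * indicator A z))
         + ennreal (t / m) * (ennreal (t / m) * (q z * indicator A z)))) \<partial>\<mu>)"
      unfolding pot f_def by (intro nn_integral_cong) (auto simp: algebra_simps)
    also have "\<dots> = ennreal (1 - t) * (ennreal (1 - t) * ennreal P)
         + (ennreal (1 - t) * (ennreal (t / m) * (\<integral>\<^sup>+z. q z \<partial>\<mu>))
         + (ennreal (1 - t) * (ennreal (t / m) * (\<integral>\<^sup>+z. shifted_potential D \<mu> z * indicator A z \<partial>\<mu>))
         + ennreal (t / m) * (ennreal (t / m) * (\<integral>\<^sup>+z. q z * indicator A z \<partial>\<mu>))))"
      by (simp add: nn_integral_add nn_integral_cmult fin(1))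
    also have "\<dots> \<le> ennreal (1 - t) * (ennreal (1 - t) * ennreal P)
         + (ennreal (1 - t) * (ennreal (t / m) * ennreal (c * m))
         + (ennreal (1 - t) * (ennreal (t / m) * ennreal (c * m))
         + ennreal (t / m) * (ennreal (t / m) * ennreal P)))"
      by (intro add_mono mult_left_mono intq potA qA) auto
    also have "\<dots> = ennreal ((1 - t) * ((1 - t) * P) + ((1 - t) * (t / m * (c * m))
         + ((1 - t) * (t / m * (c * m)) + t / m * (t / m * P))))"
      using t m c fin by (simp add: ennreal_mult'[symmetric] del: times_divide_eq_left times_divide_eq_right flip: ennreal_plus)
    finally have "ennreal P \<le> \<dots>" using min[OF \<nu>] by (rule order_trans[rotated])
    then have "P \<le> (1 - t) * ((1 - t) * P) + ((1 - t) * (t / m * (c * m))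
         + ((1 - t) * (t / m * (c * m)) + t / m * (t / m * P)))"
      using t m c fin by (subst (asm) ennreal_le_iff) (auto intro!: add_nonneg_nonneg mult_nonneg_nonneg)
    then show ?thesis using m by (simp add: power2_eq_square algebra_simps)
  qed
  define C where "C = P - 2 * c + P / m\<^sup>2"
  \<comment> \<open>With this \<open>t\<close> the term of second order is at most \<open>t (P - c)\<close>, half the gain of first order.\<close>
  define t where "t = min 1 ((P - c) / (\<bar>C\<bar> + 1))"
  have t: "0 < t" "t \<le> 1" using c by (auto simp: t_def)
  have "t * (2 * (P - c)) \<le> t * (t * C)"
    using key[of t] t unfolding C_def by (simp add: power2_eq_square algebra_simps)
  then have "2 * (P - c) \<le> t * C" using t by simp
  also have "\<dots> \<le> t * (\<bar>C\<bar> + 1)" using t by (intro mult_left_mono) auto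
  also have "\<dots> \<le> (P - c) / (\<bar>C\<bar> + 1) * (\<bar>C\<bar> + 1)"
    by (intro mult_right_mono) (auto simp: t_def)
  also have "\<dots> = P - c" by simp
  finally show False using c by simp
qed

text \<open>The potential is almost nowhere below its mean \<open>P\<close>, so it equals \<open>P\<close> almost everywhere.\<close>

lemma energy_minimizer_potential_AE:
  assumes \<mu>: "\<mu> \<in> prob_measures_on K" and K: "compact K"
    and fin: "(\<integral>\<^sup>+z. shifted_potential D \<mu> z \<partial>\<mu>) = ennreal P" "0 \<le> P"
    and min: "\<And>\<nu>. \<nu> \<in> prob_measures_on K \<Longrightarrow> ennreal P \<le> (\<integral>\<^sup>+z. shifted_potential D \<nu> z \<partial>\<nu>)"
  shows "AE z in \<mu>. shifted_potential D \<mu> z = ennreal P"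
proof -
  note \<mu>' = prob_measures_onD[OF \<mu>]
  interpret prob_space \<mu> using \<mu>' by auto
  have [measurable_cong, simp]: "sets \<mu> = sets borel" by (fact \<mu>')
  note [measurable] = measurable_shifted_potential[OF \<mu>'(2,1), of D]
  have "AE z in \<mu>. \<forall>n. ennreal (P - 1 / real (Suc n)) \<le> shifted_potential D \<mu> z"
  proof (subst AE_all_countable, intro allI)
    fix n
    show "AE z in \<mu>. ennreal (P - 1 / real (Suc n)) \<le> shifted_potential D \<mu> z"
    proof (cases "P - 1 / real (Suc n) \<ge> 0")
      case True
      then have "emeasure \<mu> {z. shifted_potential D \<mu> z \<le> ennreal (P - 1 / real (Suc n))} = 0"
        by (intro energy_minimizer_sublevel_null[OF \<mu> K fin min]) auto
      then show ?thesis
        by (intro AE_I[of _ _ "{z. shifted_potential D \<mu> z \<le> ennreal (P - 1 / real (Suc n))}"]) auto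
    qed (simp add: ennreal_neg)
  qed
  then have ge: "AE z in \<mu>. ennreal P \<le> shifted_potential D \<mu> z"
  proof (rule eventually_mono)
    fix z assume *: "\<forall>n. ennreal (P - 1 / real (Suc n)) \<le> shifted_potential D \<mu> z"
    have "(\<lambda>n. ennreal (P - 1 / real (Suc n))) \<longlonglongrightarrow> ennreal (P - 0)"
      using LIMSEQ_inverse_real_of_nat by (intro tendsto_ennrealI tendsto_intros) (simp add: inverse_eq_divide)
    then show "ennreal P \<le> shifted_potential D \<mu> z"
      using * by (intro LIMSEQ_le_const2[of _ "ennreal P"]) auto
  qed
  have "(\<integral>\<^sup>+z. shifted_potential D \<mu> z - ennreal P \<partial>\<mu>) = 0"
    using ge by (subst nn_integral_diff) (auto simp: fin(1) emeasure_space_1)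
  then have "AE z in \<mu>. shifted_potential D \<mu> z - ennreal P = 0"
    by (subst (asm) nn_integral_0_iff_AE) auto
  then show ?thesis
    using ge by eventually_elim (metis antisym diff_eq_0_iff_ennreal ennreal_less_top leI not_less_iff_gr_or_eq order_le_less)
qed

section \<open>The logarithmic potential outside the support\<close>

text \<open>
  The sign is such that this is the mean of \<open>ln \<bar>P\<bar>\<close> for the monic polynomial \<open>P\<close>
  of degree 1 with root \<open>z\<close>. As \<open>ln 0 = 0\<close>, an atom at \<open>z\<close> would contribute nothing; all measures of interest are free of atoms.
\<close>

definition log_potential :: "complex measure \<Rightarrow> complex \<Rightarrow> real" where
  "log_potential \<mu> z = (LINT w|\<mu>. ln (cmod (z - w)))"

lemma integrable_ln_off:
  assumes "\<mu> \<in> prob_measures_on S" "compact S" "z \<notin> S"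
  shows "integrable \<mu> (\<lambda>w. ln (cmod (z - w)))"
  using assms by (intro integrable_prob_measures_on[OF assms(1,2)] continuous_intros) auto

lemma ln_diff_le:
  assumes "0 < (a::real)" "\<rho> \<le> b" "0 < \<rho>"
  shows "ln a - ln b \<le> \<bar>a - b\<bar> / \<rho>"
proof -
  have "ln a - ln b = ln (a / b)" using assms by (simp add: ln_div)
  also have "\<dots> \<le> a / b - 1" using assms by (intro ln_le_minus_one) auto
  also have "\<dots> = (a - b) / b" using assms by (simp add: field_simps)
  also have "\<dots> \<le> \<bar>a - b\<bar> / \<rho>" using assms by (intro frac_le) auto
  finally show ?thesis .
qed

lemma ln_cmod_diff_le:
  assumes "z \<noteq> w" "\<rho> \<le> cmod (z' - w)" "0 < \<rho>"
  shows "ln (cmod (z - w)) - ln (cmod (z' - w)) \<le> dist z z' / \<rho>"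
proof -
  have "ln (cmod (z - w)) - ln (cmod (z' - w)) \<le> \<bar>cmod (z - w) - cmod (z' - w)\<bar> / \<rho>"
    using assms by (intro ln_diff_le) auto
  also have "\<dots> \<le> dist z z' / \<rho>"
    using norm_triangle_ineq3[of "z - w" "z' - w"] assms(3) by (intro divide_right_mono) (auto simp: dist_norm)
  finally show ?thesis .
qed

lemma log_potential_continuous_off:
  assumes \<mu>: "\<mu> \<in> prob_measures_on S" and S: "compact S"
  shows "continuous_on (- S) (log_potential \<mu>)"
proof (rule continuous_at_imp_continuous_on, rule ballI)
  interpret prob_space \<mu> using prob_measures_onD[OF \<mu>] by auto
  fix z assume z: "z \<in> - S"
  have "open (- S)" using S by (simp add: compact_imp_closed open_Compl)
  then obtain e where e: "e > 0" "ball z e \<subseteq> - S" using z open_contains_ball by blast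
  have ge: "e / 2 \<le> cmod (z' - w)" if "z' \<in> ball z (e / 2)" "w \<in> S" for z' w
  proof -
    have "w \<notin> ball z e" using e that by auto
    then show ?thesis using that(1) dist_triangle[of z w z'] by (auto simp: dist_norm)
  qed
  have le: "log_potential \<mu> z1 - log_potential \<mu> z2 \<le> dist z1 z2 / (e / 2)"
    if z12: "z1 \<in> ball z (e / 2)" "z2 \<in> ball z (e / 2)" for z1 z2
  proof -
    have "z1 \<notin> S" "z2 \<notin> S" using ge[OF z12(1), of z1] ge[OF z12(2), of z2] e by fastforce+
    then have int: "integrable \<mu> (\<lambda>w. ln (cmod (z1 - w)))" "integrable \<mu> (\<lambda>w. ln (cmod (z2 - w)))"
      using integrable_ln_off[OF \<mu> S] by auto
    have "log_potential \<mu> z1 - log_potential \<mu> z2 = (LINT w|\<mu>. ln (cmod (z1 - w)) - ln (cmod (z2 - w)))"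
      unfolding log_potential_def by (simp add: int)
    also have "\<dots> \<le> (LINT w|\<mu>. dist z1 z2 / (e / 2))"
    proof (intro integral_mono_AE)
      have "ln (cmod (z1 - w)) - ln (cmod (z2 - w)) \<le> dist z1 z2 / (e / 2)" if w: "w \<in> S" for w
        using ge[OF z12(2) w] e \<open>z1 \<notin> S\<close> w by (intro ln_cmod_diff_le) auto
      then show "AE w in \<mu>. ln (cmod (z1 - w)) - ln (cmod (z2 - w)) \<le> dist z1 z2 / (e / 2)"
        using prob_measures_on_AE[OF \<mu>] S by (auto simp: borel_compact elim!: eventually_mono)
    qed (auto simp: int)
    finally show ?thesis by (simp add: prob_space)
  qed
  show "isCont (log_potential \<mu>) z"
  proof (rule continuous_at_imp_continuous_at_within, unfold continuous_at_eps_delta, intro allI impI)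
    fix \<epsilon> :: real assume "\<epsilon> > 0"
    define \<delta> where "\<delta> = min (e / 2) (\<epsilon> * e / 4)"
    have "\<delta> > 0" using e \<open>\<epsilon> > 0\<close> by (simp add: \<delta>_def)
    moreover have "dist (log_potential \<mu> z') (log_potential \<mu> z) < \<epsilon>" if "dist z' z < \<delta>" for z'
    proof -
      have "\<bar>log_potential \<mu> z' - log_potential \<mu> z\<bar> \<le> dist z z' / (e / 2)"
        using le[of z z'] le[of z' z] that e by (auto simp: \<delta>_def dist_commute)
      also have "\<dots> \<le> (\<epsilon> * e / 4) / (e / 2)"
        using that e by (intro divide_right_mono) (auto simp: \<delta>_def dist_commute)
      also have "\<dots> < \<epsilon>" using e \<open>\<epsilon> > 0\<close> by simp
      finally show ?thesis by (simp add: dist_real_def)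
    qed
    ultimately show "\<exists>\<delta>>0. \<forall>z'. dist z' z < \<delta> \<longrightarrow> dist (log_potential \<mu> z') (log_potential \<mu> z) < \<epsilon>"
      by blast
  qed
qed

lemma small_ball_measure:
  assumes \<mu>: "\<mu> \<in> prob_measures_on S" and atom: "emeasure \<mu> {a} = 0" and "\<epsilon> > 0"
  shows "\<exists>r>0. measure \<mu> (cball a r) < \<epsilon>"
proof -
  interpret prob_space \<mu> using prob_measures_onD[OF \<mu>] by auto
  define r where "r n = inverse (real (Suc n))" for n
  have "(\<lambda>n. measure \<mu> (cball a (r n))) \<longlonglongrightarrow> measure \<mu> (\<Inter>n. cball a (r n))"
  proof (rule finite_Lim_measure_decseq)
    show "range (\<lambda>n. cball a (r n)) \<subseteq> sets \<mu>" unfolding prob_measures_onD(2)[OF \<mu>] by auto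
    show "decseq (\<lambda>n. cball a (r n))"
      unfolding decseq_def r_def by (intro allI impI subset_cball le_imp_inverse_le) auto
  qed
  moreover have "(\<Inter>n. cball a (r n)) = {a}"
  proof -
    have "x = a" if "\<And>n. dist a x \<le> r n" for x
    proof (rule ccontr)
      assume "x \<noteq> a"
      then obtain n where "inverse (real (Suc n)) < dist a x"
        using reals_Archimedean[of "dist a x"] by auto
      then show False using that[of n] by (simp add: r_def)
    qed
    then show ?thesis by (auto simp: r_def)
  qed
  ultimately have "(\<lambda>n. measure \<mu> (cball a (r n))) \<longlonglongrightarrow> 0"
    using atom by (simp add: measure_def)
  then have "eventually (\<lambda>n. measure \<mu> (cball a (r n)) < \<epsilon>) sequentially"
    using \<open>\<epsilon> > 0\<close> by (rule order_tendstoD)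
  then obtain n where "measure \<mu> (cball a (r n)) < \<epsilon>"
    by (meson eventually_sequentially order_refl)
  then show ?thesis by (intro exI[of _ "r n"]) (simp add: r_def)
qed

text \<open>
  A lower bound for the potential on \<open>S\<close> persists in the limit from outside. If \<open>y\<close> is a point of \<open>S\<close>
  nearest to \<open>z\<close>, then \<open>\<bar>y - w\<bar> \<le> 2 \<bar>z - w\<bar>\<close> for \<open>w \<in> S\<close>, which costs \<open>ln 2\<close> times the small mass near \<open>z0\<close>;
  away from \<open>z0\<close> the kernels at \<open>y\<close> and \<open>z\<close> are close.
\<close>

lemma log_potential_boundary:
  assumes \<mu>: "\<mu> \<in> prob_measures_on S" and S: "compact S" and atoms: "\<And>a. emeasure \<mu> {a} = 0"
    and int: "\<And>z. z \<in> S \<Longrightarrow> integrable \<mu> (\<lambda>w. ln (cmod (z - w)))"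
    and ge: "\<And>z. z \<in> S \<Longrightarrow> c \<le> log_potential \<mu> z"
    and z0: "z0 \<in> S" and eps: "\<epsilon> > 0"
  shows "\<exists>\<delta>>0. \<forall>z. z \<notin> S \<longrightarrow> dist z z0 < \<delta> \<longrightarrow> c - \<epsilon> \<le> log_potential \<mu> z"
proof -
  interpret prob_space \<mu> using prob_measures_onD[OF \<mu>] by auto
  have [measurable_cong, simp]: "sets \<mu> = sets borel" by (fact prob_measures_onD[OF \<mu>])
  obtain r where r: "r > 0" "measure \<mu> (cball z0 r) < \<epsilon> / (2 * ln 2)"
    using small_ball_measure[OF \<mu> atoms, of "\<epsilon> / (2 * ln 2)" z0] eps by auto
  define \<delta> where "\<delta> = min (r / 4) (\<epsilon> * r / 4)"
  have \<delta>: "\<delta> > 0" "\<delta> \<le> r / 4" "\<delta> \<le> \<epsilon> * r / 4" using r eps by (auto simp: \<delta>_def)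
  have "c - \<epsilon> \<le> log_potential \<mu> z" if z: "z \<notin> S" "dist z z0 < \<delta>" for z
  proof -
    obtain y where y: "y \<in> S" "\<And>w. w \<in> S \<Longrightarrow> dist z y \<le> dist z w"
      using distance_attains_inf[of S z] z0 S by (auto simp: compact_imp_closed)
    have zy: "dist z y < \<delta>" using y(2)[OF z0] z by simp
    have pw: "ln (cmod (y - w)) - (ln 2 * indicator (cball z0 r) w + \<epsilon> / 2) \<le> ln (cmod (z - w))"
      if w: "w \<in> S" "w \<noteq> y" for w
    proof (cases "w \<in> cball z0 r")
      case True
      have "cmod (y - w) \<le> 2 * cmod (z - w)"
        using y(2)[OF w(1)] dist_triangle[of y w z] by (simp add: dist_norm norm_minus_commute)
      then have "ln (cmod (y - w)) \<le> ln (2 * cmod (z - w))"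
        using w by (subst ln_le_cancel_iff) auto
      also have "\<dots> = ln 2 + ln (cmod (z - w))"
        using w z by (subst ln_mult) auto
      finally show ?thesis using True eps by simp
    next
      case False
      have "r / 2 \<le> cmod (z - w)"
        using False z \<delta>(2) dist_triangle[of z0 w z] r by (auto simp: dist_norm norm_minus_commute)
      then have "ln (cmod (y - w)) - ln (cmod (z - w)) \<le> dist y z / (r / 2)"
        using w r by (intro ln_cmod_diff_le) auto
      also have "\<dots> \<le> (\<epsilon> * r / 4) / (r / 2)"
        using zy \<delta> r by (intro divide_right_mono) (auto simp: dist_commute)
      also have "\<dots> = \<epsilon> / 2" using r by simp
      finally show ?thesis using False by simp
    qed
    have ind: "integrable \<mu> (indicator (cball z0 r) :: complex \<Rightarrow> real)"
      by (rule integrable_real_indicator) (auto simp: emeasure_eq_measure)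
    have ln2: "ln 2 * measure \<mu> (cball z0 r) \<le> \<epsilon> / 2"
      using r(2) by (simp add: field_simps)
    have "c - \<epsilon> \<le> log_potential \<mu> y - (ln 2 * measure \<mu> (cball z0 r) + \<epsilon> / 2)"
      using ge[OF y(1)] ln2 by simp
    also have "\<dots> = (LINT w|\<mu>. ln (cmod (y - w)) - (ln 2 * indicator (cball z0 r) w + \<epsilon> / 2))"
      unfolding log_potential_def using int[OF y(1)]
      by (simp add: prob_space ind)
    also have "\<dots> \<le> log_potential \<mu> z"
      unfolding log_potential_def
    proof (rule integral_mono_AE)
      show "integrable \<mu> (\<lambda>w. ln (cmod (y - w)) - (ln 2 * indicator (cball z0 r) w + \<epsilon> / 2))"
        using int[OF y(1)] ind by auto
      show "integrable \<mu> (\<lambda>w. ln (cmod (z - w)))"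
        by (rule integrable_ln_off[OF \<mu> S z(1)])
      have "AE w in \<mu>. w \<noteq> y" using atoms[of y] by (intro AE_I[of _ _ "{y}"]) auto
      moreover have "AE w in \<mu>. w \<in> S" using prob_measures_on_AE[OF \<mu>] S by (simp add: borel_compact)
      ultimately show "AE w in \<mu>. ln (cmod (y - w)) - (ln 2 * indicator (cball z0 r) w + \<epsilon> / 2) \<le> ln (cmod (z - w))"
        by eventually_elim (rule pw)
    qed
    finally show ?thesis .
  qed
  then show ?thesis using \<delta>(1) by blast
qed

text \<open>
  An approximate mean value property. The product of \<open>u + \<i>\<^sup>k h\<close> over the four values of \<open>k\<close> is \<open>u\<^sup>4 - h\<^sup>4\<close>, so
  the error is of order \<open>h\<^sup>4\<close>.
\<close>

lemma ln_cmod_four_points: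
  assumes "d \<le> cmod u" "0 \<le> h" "h < d"
  shows "ln (cmod (u + of_real h)) + ln (cmod (u - of_real h))
    + ln (cmod (u + \<i> * of_real h)) + ln (cmod (u - \<i> * of_real h))
    \<le> 4 * ln (cmod u) + (h / d) ^ 4"
proof -
  have u: "0 < cmod u" using assms by linarith
  have pos: "0 < 1 + (h / cmod u) ^ 4" by (intro add_pos_nonneg) auto
  have nz: "u + v \<noteq> 0" if "cmod v = h" for v
    using assms that by (metis add_eq_0_iff norm_minus_cancel not_le)
  have "ln (cmod (u + of_real h)) + ln (cmod (u - of_real h))
    + ln (cmod (u + \<i> * of_real h)) + ln (cmod (u - \<i> * of_real h))
    = ln (cmod ((u + of_real h) * (u - of_real h) * (u + \<i> * of_real h) * (u - \<i> * of_real h)))"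
    using nz[of "of_real h"] nz[of "- of_real h"] nz[of "\<i> * of_real h"] nz[of "- \<i> * of_real h"] assms(2)
    by (simp add: ln_mult norm_mult)
  also have "(u + of_real h) * (u - of_real h) * (u + \<i> * of_real h) * (u - \<i> * of_real h) = u ^ 4 - of_real h ^ 4"
    by (simp add: algebra_simps power4_eq_xxxx power2_eq_square)
  also have "ln (cmod (u ^ 4 - of_real h ^ 4)) \<le> ln (cmod u ^ 4 * (1 + (h / cmod u) ^ 4))"
  proof (subst ln_le_cancel_iff)
    have "cmod (of_real h ^ 4) < cmod (u ^ 4)"
      using assms by (simp add: norm_power power_strict_mono)
    then show "0 < cmod (u ^ 4 - of_real h ^ 4)" by auto
    have "cmod (u ^ 4 - of_real h ^ 4) \<le> cmod u ^ 4 + h ^ 4"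
      using norm_triangle_ineq4[of "u ^ 4" "of_real h ^ 4"] assms by (simp add: norm_power)
    then show "cmod (u ^ 4 - of_real h ^ 4) \<le> cmod u ^ 4 * (1 + (h / cmod u) ^ 4)"
      using u by (simp add: power_divide distrib_left)
    show "0 < cmod u ^ 4 * (1 + (h / cmod u) ^ 4)"
      using u assms by (intro mult_pos_pos add_pos_nonneg) auto
  qed
  also have "\<dots> = 4 * ln (cmod u) + ln (1 + (h / cmod u) ^ 4)"
    using u pos by (simp add: ln_mult ln_realpow)
  also have "ln (1 + (h / cmod u) ^ 4) \<le> (h / cmod u) ^ 4"
    using assms by (intro ln_add_one_self_le_self) auto
  also have "(h / cmod u) ^ 4 \<le> (h / d) ^ 4"
    using assms u by (intro power_mono divide_left_mono) auto
  finally show ?thesis by simp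
qed

lemma log_potential_four_points:
  assumes \<mu>: "\<mu> \<in> prob_measures_on S" and S: "compact S"
    and d: "\<And>w. w \<in> S \<Longrightarrow> d \<le> cmod (z - w)" and h: "0 \<le> h" "h < d"
  shows "log_potential \<mu> (z + of_real h) + log_potential \<mu> (z - of_real h)
    + log_potential \<mu> (z + \<i> * of_real h) + log_potential \<mu> (z - \<i> * of_real h)
    \<le> 4 * log_potential \<mu> z + (h / d) ^ 4"
proof -
  interpret prob_space \<mu> using prob_measures_onD[OF \<mu>] by auto
  have off: "z + v \<notin> S" if "cmod v < d" for v using d[of "z + v"] that by auto
  have int0: "integrable \<mu> (\<lambda>w. ln (cmod (z + v - w)))" if "cmod v \<le> h" for v
    using that h by (intro integrable_ln_off[OF \<mu> S off]) simp
  have int [simp]: "integrable \<mu> (\<lambda>w. ln (cmod (z + of_real h - w)))"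
    "integrable \<mu> (\<lambda>w. ln (cmod (z - of_real h - w)))"
    "integrable \<mu> (\<lambda>w. ln (cmod (z + \<i> * of_real h - w)))"
    "integrable \<mu> (\<lambda>w. ln (cmod (z - \<i> * of_real h - w)))"
    "integrable \<mu> (\<lambda>w. ln (cmod (z - w)))"
    using int0[of "of_real h"] int0[of "- of_real h"] int0[of "\<i> * of_real h"]
      int0[of "- (\<i> * of_real h)"] int0[of 0] h
    by (simp_all add: norm_mult)
  have "log_potential \<mu> (z + of_real h) + log_potential \<mu> (z - of_real h)
    + log_potential \<mu> (z + \<i> * of_real h) + log_potential \<mu> (z - \<i> * of_real h)
    = (LINT w|\<mu>. ln (cmod (z + of_real h - w)) + ln (cmod (z - of_real h - w))
       + ln (cmod (z + \<i> * of_real h - w)) + ln (cmod (z - \<i> * of_real h - w)))"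
    unfolding log_potential_def by simp
  also have "\<dots> \<le> (LINT w|\<mu>. 4 * ln (cmod (z - w)) + (h / d) ^ 4)"
  proof (rule integral_mono_AE)
    have "ln (cmod (z + of_real h - w)) + ln (cmod (z - of_real h - w))
       + ln (cmod (z + \<i> * of_real h - w)) + ln (cmod (z - \<i> * of_real h - w))
       \<le> 4 * ln (cmod (z - w)) + (h / d) ^ 4" if "w \<in> S" for w
      using ln_cmod_four_points[OF d[OF that] h] by (simp add: algebra_simps)
    then show "AE w in \<mu>. ln (cmod (z + of_real h - w)) + ln (cmod (z - of_real h - w))
       + ln (cmod (z + \<i> * of_real h - w)) + ln (cmod (z - \<i> * of_real h - w))
       \<le> 4 * ln (cmod (z - w)) + (h / d) ^ 4"
      using prob_measures_on_AE[OF \<mu>] S by (auto simp: borel_compact elim!: eventually_mono)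
  qed auto
  also have "\<dots> = 4 * log_potential \<mu> z + (h / d) ^ 4"
    unfolding log_potential_def by (simp add: prob_space)
  finally show ?thesis .
qed

section \<open>Minimum principle and Frostman inequality\<close>

text \<open>
  Suppose \<open>p(z) < c\<close>. Subtracting \<open>\<epsilon> \<bar>v\<bar>\<^sup>2\<close> with small \<open>\<epsilon>\<close> from \<open>p(v)\<close> gives a function \<open>q\<close> whose
  minimum over a large disc without \<open>S\<close> is still attained, at an interior point \<open>y\<close>. At \<open>y\<close> the mean of \<open>q\<close>
  over the four points at distance \<open>h\<close> is at most
  \<open>q(y) - \<epsilon> h\<^sup>2 + O(h\<^sup>4)\<close>, hence below \<open>q(y)\<close> for small \<open>h\<close>, contradicting minimality.
\<close>

theorem log_potential_minimum_principle:
  assumes \<mu>: "\<mu> \<in> prob_measures_on S" and S: "compact S" and atoms: "\<And>a. emeasure \<mu> {a} = 0"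
    and int: "\<And>z. z \<in> S \<Longrightarrow> integrable \<mu> (\<lambda>w. ln (cmod (z - w)))"
    and ge: "\<And>z. z \<in> S \<Longrightarrow> c \<le> log_potential \<mu> z"
  shows "c \<le> log_potential \<mu> z"
proof (rule ccontr)
  interpret prob_space \<mu> using prob_measures_onD[OF \<mu>] by auto
  assume less: "\<not> c \<le> log_potential \<mu> z"
  then have z: "z \<notin> S" using ge by auto
  define \<eta> where "\<eta> = (c - log_potential \<mu> z) / 2"
  have "2 * \<eta> = c - log_potential \<mu> z" by (simp add: \<eta>_def)
  then have \<eta>: "\<eta> > 0" "log_potential \<mu> z = c - 2 * \<eta>" using less by linarith+
  obtain R0 where R0: "\<And>w. w \<in> S \<Longrightarrow> cmod w \<le> R0"
    using compact_imp_bounded[OF S] bounded_iff by blast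
  \<comment> \<open>Beyond this radius all distances to \<open>S\<close> are at least \<open>exp c\<close>, so that \<open>p \<ge> c\<close>.\<close>
  define R where "R = max (max 1 (cmod z)) (R0 + exp c)"
  have R: "R > 0" "cmod z \<le> R" "R0 + exp c \<le> R" by (auto simp: R_def)
  have far: "c \<le> log_potential \<mu> v" if v: "cmod v \<ge> R" for v
  proof (cases "v \<in> S")
    case False
    have "(LINT w|\<mu>. c) \<le> log_potential \<mu> v"
      unfolding log_potential_def
    proof (rule integral_mono_AE)
      have "c \<le> ln (cmod (v - w))" if "w \<in> S" for w
      proof -
        have "exp c \<le> cmod (v - w)"
          using R0[OF that] v R(3) norm_triangle_ineq2[of v w] by linarith
        then show ?thesis by (smt (verit) exp_gt_zero ln_ge_iff)
      qed
      then show "AE w in \<mu>. c \<le> ln (cmod (v - w))"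
        using prob_measures_on_AE[OF \<mu>] S by (auto simp: borel_compact elim!: eventually_mono)
    qed (auto intro: integrable_ln_off[OF \<mu> S False])
    then show ?thesis by (simp add: prob_space)
  qed (rule ge)
  define \<epsilon> where "\<epsilon> = \<eta> / R\<^sup>2"
  have \<epsilon>: "\<epsilon> > 0" "\<epsilon> * R\<^sup>2 = \<eta>" using \<eta> R by (auto simp: \<epsilon>_def)
  define q where "q v = log_potential \<mu> v - \<epsilon> * (cmod v)\<^sup>2" for v
  have q_le: "log_potential \<mu> v \<le> q v + \<eta>" if "cmod v \<le> R" for v
  proof -
    have "\<epsilon> * (cmod v)\<^sup>2 \<le> \<epsilon> * R\<^sup>2"
      using \<epsilon>(1) that by (intro mult_left_mono power_mono) auto
    then show ?thesis using \<epsilon>(2) by (simp add: q_def)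
  qed
  have contq: "continuous_on (- S) q"
    unfolding q_def by (intro continuous_intros log_potential_continuous_off[OF \<mu> S])
  \<comment> \<open>Points of \<open>A\<close> have \<open>p \<le> c - \<eta>\<close>, so they accumulate neither at \<open>S\<close> nor on the circle of radius \<open>R\<close>.\<close>
  define A where "A = {v \<in> cball 0 R - S. q v \<le> c - 2 * \<eta>}"
  have zA: "z \<in> A"
    using z R \<eta> \<epsilon> by (auto simp: A_def q_def)
  have "closed A"
    unfolding closed_sequential_limits
  proof (intro allI impI, elim conjE)
    fix X l assume X: "\<forall>n::nat. X n \<in> A" "X \<longlonglongrightarrow> l"
    have "l \<in> cball 0 R"
      using X by (intro closed_sequentially[of "cball 0 R" X l]) (auto simp: A_def)
    moreover have "l \<notin> S"
    proof
      assume "l \<in> S"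
      then obtain \<delta> where \<delta>: "\<delta> > 0" "\<And>v. v \<notin> S \<Longrightarrow> dist v l < \<delta> \<Longrightarrow> c - \<eta> / 2 \<le> log_potential \<mu> v"
        using log_potential_boundary[OF \<mu> S atoms int ge, of l "\<eta> / 2"] \<eta>(1) by auto
      obtain n where "dist (X n) l < \<delta>"
        using X(2) \<delta>(1) by (meson lim_sequentially order_refl)
      then have "c - \<eta> / 2 \<le> log_potential \<mu> (X n)"
        using \<delta>(2) X(1) by (auto simp: A_def)
      moreover have "log_potential \<mu> (X n) \<le> c - 2 * \<eta> + \<eta>"
      proof -
        have "cmod (X n) \<le> R" "q (X n) \<le> c - 2 * \<eta>"
          using X(1)[rule_format, of n] by (auto simp: A_def)
        then show ?thesis using q_le[of "X n"] by linarith
      qed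
      ultimately show False using \<eta>(1) by simp
    qed
    moreover have "q l \<le> c - 2 * \<eta>"
    proof -
      have "isCont q l"
        using contq \<open>l \<notin> S\<close> S by (auto simp: continuous_on_eq_continuous_at compact_imp_closed open_Compl)
      then have "(\<lambda>n. q (X n)) \<longlonglongrightarrow> q l"
        using X(2) by (rule isCont_tendsto_compose)
      then show ?thesis
        using X(1) by (intro LIMSEQ_le_const2) (auto simp: A_def)
    qed
    ultimately show "l \<in> A" by (simp add: A_def)
  qed
  moreover have "bounded A" by (rule bounded_subset[of "cball 0 R"]) (auto simp: A_def)
  ultimately have "compact A" by (simp add: compact_eq_bounded_closed)
  moreover have "continuous_on A q" by (rule continuous_on_subset[OF contq]) (auto simp: A_def)
  ultimately obtain y where y: "y \<in> A" "\<And>v. v \<in> A \<Longrightarrow> q y \<le> q v"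
    using continuous_attains_inf[of A q] zA by auto
  have ylt: "cmod y < R"
  proof (rule ccontr)
    assume "\<not> cmod y < R"
    then have "cmod y = R" "cmod y \<ge> R" using y(1) by (auto simp: A_def)
    then show False using q_le[of y] far[of y] y(1) \<eta>(1) by (simp add: A_def)
  qed
  have "open (ball 0 R - S)" using S by (intro open_Diff) (auto simp: compact_imp_closed)
  moreover have "y \<in> ball 0 R - S" using y(1) ylt by (auto simp: A_def)
  ultimately obtain d where d: "d > 0" "ball y d \<subseteq> ball 0 R - S"
    by (meson open_contains_ball)
  have min: "q y \<le> q v" if "v \<in> ball y d" for v
    using y d(2) that by (cases "v \<in> A") (auto simp: A_def)
  have dS: "d \<le> cmod (y - w)" if "w \<in> S" for w
  proof -
    have "w \<notin> ball y d" using d(2) that by auto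
    then show ?thesis by (simp add: dist_norm)
  qed
  \<comment> \<open>Then \<open>h\<^sup>4 / d\<^sup>4 \<le> \<epsilon> h\<^sup>2\<close>, so the error of the mean value property is smaller than the gain \<open>4 \<epsilon> h\<^sup>2\<close>.\<close>
  define h where "h = min (d / 2) (d\<^sup>2 * sqrt \<epsilon>)"
  have h: "0 < h" "h < d" "h \<le> d\<^sup>2 * sqrt \<epsilon>" using d \<epsilon> by (auto simp: h_def)
  have hm: "q y \<le> q (y + of_real h)" "q y \<le> q (y - of_real h)"
    "q y \<le> q (y + \<i> * of_real h)" "q y \<le> q (y - \<i> * of_real h)"
    using h by (auto intro!: min simp: dist_norm norm_mult)
  have sq: "(cmod (y + of_real h))\<^sup>2 + (cmod (y - of_real h))\<^sup>2
     + (cmod (y + \<i> * of_real h))\<^sup>2 + (cmod (y - \<i> * of_real h))\<^sup>2 = 4 * (cmod y)\<^sup>2 + 4 * h\<^sup>2"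
    unfolding cmod_power2 by (simp add: power2_eq_square algebra_simps)
  have "4 * q y \<le> 4 * log_potential \<mu> y + (h / d) ^ 4 - \<epsilon> * (4 * (cmod y)\<^sup>2 + 4 * h\<^sup>2)"
    using hm log_potential_four_points[OF \<mu> S dS, of h] h
    unfolding sq[symmetric] by (simp add: q_def algebra_simps)
  then have "4 * \<epsilon> * h\<^sup>2 \<le> (h / d) ^ 4"
    by (simp add: q_def algebra_simps)
  also have "\<dots> = h\<^sup>2 * (h\<^sup>2 / d ^ 4)"
    by (simp add: power_divide power2_eq_square power4_eq_xxxx)
  finally have "h\<^sup>2 * (4 * \<epsilon>) \<le> h\<^sup>2 * (h\<^sup>2 / d ^ 4)" by (simp add: mult_ac)
  then have "4 * \<epsilon> \<le> h\<^sup>2 / d ^ 4"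
    by (rule mult_left_le_imp_le) (use h in simp)
  also have "\<dots> \<le> (d\<^sup>2 * sqrt \<epsilon>)\<^sup>2 / d ^ 4"
    using h by (intro divide_right_mono power_mono) auto
  also have "\<dots> = \<epsilon>" using d \<epsilon> by (simp add: power_mult_distrib flip: power_mult)
  finally show False using \<epsilon> by simp
qed

lemma compact_diameter_bound:
  fixes K :: "complex set"
  assumes "compact K"
  obtains D where "D \<ge> 1" "\<And>z w. z \<in> K \<Longrightarrow> w \<in> K \<Longrightarrow> dist z w \<le> D"
proof -
  obtain B where "\<And>z. z \<in> K \<Longrightarrow> cmod z \<le> B"
    using compact_imp_bounded[OF assms] bounded_iff by blast
  then have "dist z w \<le> max 1 (2 * B)" if "z \<in> K" "w \<in> K" for z w
    using norm_triangle_ineq4[of z w] that unfolding dist_norm by (smt (verit))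
  then show thesis by (intro that[of "max 1 (2 * B)"]) auto
qed

lemma robin_constant_le:
  assumes "\<nu> \<in> prob_measures_on K"
  shows "robin_constant K \<le> log_energy \<nu>"
  unfolding robin_constant_def by (rule INF_lower[OF assms])

text \<open>Frostman's inequality: the potential of the equilibrium measure is nowhere below \<open>- V\<close>.\<close>

theorem frostman:
  assumes eq: "is_equilibrium_measure K \<mu>" and K: "compact K" and np: "non_polar K"
  obtains V where "robin_constant K = ereal V" "\<And>a. emeasure \<mu> {a} = 0"
    "\<And>z. integrable \<mu> (\<lambda>w. ln (cmod (z - w)))" "\<And>z. - V \<le> log_potential \<mu> z"
proof -
  have \<mu>: "\<mu> \<in> prob_measures_on K" and energy: "log_energy \<mu> = robin_constant K"
    using eq by (auto simp: is_equilibrium_measure_def)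
  note \<mu>' = prob_measures_onD[OF \<mu>]
  interpret prob_space \<mu> using \<mu>' by auto
  have [measurable_cong, simp]: "sets \<mu> = sets borel" by (fact \<mu>')
  obtain D where D: "D \<ge> 1" "\<And>z w. z \<in> K \<Longrightarrow> w \<in> K \<Longrightarrow> dist z w \<le> D"
    using compact_diameter_bound[OF K] by blast
  have lnD: "ln D \<ge> 0" using D by simp
  have shifted: "log_energy \<nu> + ereal (ln D) = enn2ereal (\<integral>\<^sup>+z. shifted_potential D \<nu> z \<partial>\<nu>)"
    if "\<nu> \<in> prob_measures_on K" for \<nu>
    by (rule log_energy_shifted[OF that K D(2,1)])
  have "robin_constant K \<noteq> \<infinity>"
    using np by (auto simp: non_polar_def capacity_def)
  then have ne: "enn2ereal (\<integral>\<^sup>+z. shifted_potential D \<mu> z \<partial>\<mu>) \<noteq> \<infinity>"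
    using shifted[OF \<mu>] energy by (cases "robin_constant K") auto
  then obtain P where P: "(\<integral>\<^sup>+z. shifted_potential D \<mu> z \<partial>\<mu>) = ennreal P" "0 \<le> P"
    by (cases "\<integral>\<^sup>+z. shifted_potential D \<mu> z \<partial>\<mu>") auto
  have V: "robin_constant K = ereal (P - ln D)"
    using shifted[OF \<mu>] energy P by (cases "robin_constant K") (auto simp: enn2ereal_ennreal)
  have min: "ennreal P \<le> (\<integral>\<^sup>+z. shifted_potential D \<nu> z \<partial>\<nu>)" if \<nu>: "\<nu> \<in> prob_measures_on K" for \<nu>
  proof -
    have "enn2ereal (ennreal P) \<le> enn2ereal (\<integral>\<^sup>+z. shifted_potential D \<nu> z \<partial>\<nu>)"
      unfolding shifted[OF \<nu>, symmetric] P(1)[symmetric] shifted[OF \<mu>, symmetric] energy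
      by (intro add_right_mono robin_constant_le \<nu>)
    then show ?thesis by (simp add: less_eq_ennreal.rep_eq)
  qed
  have atoms: "emeasure \<mu> {a} = 0" for a
    using no_atoms_if_finite_energy[OF \<mu>, of D a] P by simp
  define S where "S = msupport \<mu>"
  have S: "compact S" "\<mu> \<in> prob_measures_on S" "S \<subseteq> K"
    using compact_msupport[OF \<mu> K] prob_measures_on_msupport[OF \<mu>] msupport_subset[OF \<mu>] K
    by (auto simp: S_def compact_imp_closed)
  define C where "C = {z. shifted_potential D \<mu> z \<le> ennreal P}"
  have "closed C" unfolding C_def by (rule closed_shifted_potential_le[OF \<mu> atoms])
  moreover have "AE z in \<mu>. z \<in> C"
    using energy_minimizer_potential_AE[OF \<mu> K P min] by (auto simp: C_def elim!: eventually_mono)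
  ultimately have "S \<subseteq> C"
    unfolding S_def using prob_space_axioms by (intro msupport_subset prob_measures_onI_AE) auto
  have on_S: "integrable \<mu> (\<lambda>w. ln (cmod (z - w))) \<and> ln D - P \<le> log_potential \<mu> z" if z: "z \<in> S" for z
  proof -
    have ne: "AE w in \<mu>. w \<noteq> z"
      using atoms[of z] by (intro AE_I[of _ _ "{z}"]) auto
    have le: "AE w in \<mu>. 0 \<le> ln D - ln (cmod (z - w))"
    proof -
      have "0 \<le> ln D - ln (cmod (z - w))" if "w \<in> K" "w \<noteq> z" for w
        using D(2)[of z w] D(1) that z S(3) by (auto simp: dist_norm)
      then show ?thesis
        using ne prob_measures_on_AE[OF \<mu>] K by (auto simp: borel_compact elim: eventually_elim2)
    qed
    have nn: "(\<integral>\<^sup>+w. ennreal (ln D - ln (cmod (z - w))) \<partial>\<mu>) = shifted_potential D \<mu> z"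
      unfolding shifted_potential_def
      using ne by (intro nn_integral_cong_AE) (auto simp: shifted_kernel_eq elim!: eventually_mono)
    have fin: "shifted_potential D \<mu> z \<le> ennreal P" using \<open>S \<subseteq> C\<close> z by (auto simp: C_def)
    have int: "integrable \<mu> (\<lambda>w. ln D - ln (cmod (z - w)))"
      using fin le unfolding nn[symmetric] by (intro integrableI_nonneg) (auto intro: order_le_less_trans)
    then have "integrable \<mu> (\<lambda>w. ln D - (ln D - ln (cmod (z - w))))"
      by (rule Bochner_Integration.integrable_diff[rotated]) simp
    then have int': "integrable \<mu> (\<lambda>w. ln (cmod (z - w)))" by simp
    have "ennreal (LINT w|\<mu>. ln D - ln (cmod (z - w))) \<le> ennreal P"
      using nn_integral_eq_integral[OF int le] nn fin by simp
    then have "(LINT w|\<mu>. ln D - ln (cmod (z - w))) \<le> P"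
      using P(2) by (simp add: ennreal_le_iff)
    moreover have "(LINT w|\<mu>. ln D - ln (cmod (z - w))) = ln D - log_potential \<mu> z"
      unfolding log_potential_def using int' by (simp add: prob_space)
    ultimately show ?thesis using int' by simp
  qed
  show thesis
  proof (rule that[OF V atoms])
    fix z
    show "integrable \<mu> (\<lambda>w. ln (cmod (z - w)))"
      using on_S[of z] integrable_ln_off[OF S(2,1), of z] by blast
    show "- (P - ln D) \<le> log_potential \<mu> z"
      using log_potential_minimum_principle[OF S(2,1) atoms, of "ln D - P" z] on_S by auto
  qed
qed

section \<open>Monic orthogonal polynomials and the lower bound\<close>

text \<open>The inner product of \<open>L\<^sup>2(\<mu>)\<close> on polynomials, linear in the first argument.\<close>

definition poly_inner :: "complex measure \<Rightarrow> complex poly \<Rightarrow> complex poly \<Rightarrow> complex" where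
  "poly_inner \<mu> p q = (LINT z|\<mu>. poly p z * cnj (poly q z))"

context
  fixes K \<mu>
  assumes \<mu>: "\<mu> \<in> prob_measures_on K" and K: "compact K"
begin

lemma integrable_poly_inner: "integrable \<mu> (\<lambda>z. poly p z * cnj (poly q z))"
proof -
  have "continuous_on UNIV (\<lambda>z. poly p z * cnj (poly q z))" by (intro continuous_intros)
  then show ?thesis
    by (intro integrable_prob_measures_on[OF \<mu> K])
       (auto intro: borel_measurable_continuous_onI continuous_on_subset)
qed

lemma integrable_poly_sq: "integrable \<mu> (\<lambda>z. (cmod (poly p z))\<^sup>2)"
proof -
  have "continuous_on UNIV (\<lambda>z. (cmod (poly p z))\<^sup>2)" by (intro continuous_intros)
  then show ?thesis
    by (intro integrable_prob_measures_on[OF \<mu> K])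
       (auto intro: borel_measurable_continuous_onI continuous_on_subset)
qed

lemma poly_inner_add_left: "poly_inner \<mu> (p + q) r = poly_inner \<mu> p r + poly_inner \<mu> q r"
  by (simp add: poly_inner_def distrib_right integrable_poly_inner)

lemma poly_inner_add_right: "poly_inner \<mu> p (q + r) = poly_inner \<mu> p q + poly_inner \<mu> p r"
  by (simp add: poly_inner_def distrib_left integrable_poly_inner)

lemma poly_inner_smult_left: "poly_inner \<mu> (smult c p) q = c * poly_inner \<mu> p q"
  by (simp add: poly_inner_def mult.assoc)

lemma poly_inner_smult_right: "poly_inner \<mu> p (smult c q) = cnj c * poly_inner \<mu> p q"
  by (simp add: poly_inner_def mult.left_commute)

lemma poly_inner_cnj: "cnj (poly_inner \<mu> p q) = poly_inner \<mu> q p"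
  unfolding poly_inner_def integral_bounded_linear[OF bounded_linear_cnj integrable_poly_inner, symmetric]
  by (simp add: mult.commute)

lemma poly_inner_self: "poly_inner \<mu> p p = complex_of_real (LINT z|\<mu>. (cmod (poly p z))\<^sup>2)"
  unfolding poly_inner_def complex_norm_square[symmetric] by (simp flip: of_real_power)

lemma L2_poly_norm_sq: "(L2_poly_norm \<mu> p)\<^sup>2 = Re (poly_inner \<mu> p p)"
  by (simp add: L2_poly_norm_def poly_inner_self Bochner_Integration.integral_nonneg)

lemma poly_inner_pythagoras:
  assumes "poly_inner \<mu> q p = 0"
  shows "(L2_poly_norm \<mu> (p + q))\<^sup>2 = (L2_poly_norm \<mu> p)\<^sup>2 + (L2_poly_norm \<mu> q)\<^sup>2"
  using assms poly_inner_cnj[of q p]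
  by (simp add: L2_poly_norm_sq poly_inner_add_left poly_inner_add_right)

lemma L2_poly_norm_nonneg: "0 \<le> L2_poly_norm \<mu> p"
  by (simp add: L2_poly_norm_def Bochner_Integration.integral_nonneg)

lemma AE_poly_nonzero:
  assumes "p \<noteq> 0" and atoms: "\<And>a. emeasure \<mu> {a} = 0"
  shows "AE z in \<mu>. poly p z \<noteq> 0"
proof -
  have "{z. poly p z = 0} = (\<Union>a\<in>{z. poly p z = 0}. {a})" by auto
  also have "\<dots> \<in> null_sets \<mu>"
    using poly_roots_finite[OF assms(1)] prob_measures_onD(2)[OF \<mu>] atoms
    by (intro null_sets_UN' countable_finite) (auto simp: null_sets_def)
  finally have "{z. poly p z = 0} \<in> null_sets \<mu>" .
  from AE_not_in[OF this] show ?thesis by simp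
qed

lemma poly_inner_self_eq_0_iff:
  assumes atoms: "\<And>a. emeasure \<mu> {a} = 0"
  shows "poly_inner \<mu> p p = 0 \<longleftrightarrow> p = 0"
proof
  interpret prob_space \<mu> using prob_measures_onD[OF \<mu>] by auto
  assume "poly_inner \<mu> p p = 0"
  then have "(LINT z|\<mu>. (cmod (poly p z))\<^sup>2) = 0" by (simp add: poly_inner_self)
  then have sq0: "AE z in \<mu>. (cmod (poly p z))\<^sup>2 = 0"
    using integral_nonneg_eq_0_iff_AE[OF integrable_poly_sq[of p]] by simp
  show "p = 0"
  proof (rule ccontr)
    assume "p \<noteq> 0"
    from AE_poly_nonzero[OF this atoms] sq0 have "AE z in \<mu>. False"
      by eventually_elim simp
    then show False by simp
  qed
qed (simp add: poly_inner_def)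

text \<open>
  Orthogonal projection onto the polynomials of degree less than \<open>n\<close>; these are described by their coefficients so
  that \<open>n = 0\<close> leaves only the zero polynomial. The induction is the Gram-Schmidt process.
\<close>

lemma orthogonal_projection:
  assumes atoms: "\<And>a. emeasure \<mu> {a} = 0"
  shows "\<exists>r. (\<forall>k\<ge>n. coeff r k = 0) \<and> (\<forall>q. (\<forall>k\<ge>n. coeff q k = 0) \<longrightarrow> poly_inner \<mu> q (p - r) = 0)"
proof (induction n arbitrary: p)
  case 0
  have "poly_inner \<mu> q p' = 0" if "\<forall>k\<ge>0. coeff q k = 0" for q p' :: "complex poly"
  proof -
    have "q = 0" using that by (intro poly_eqI) auto
    then show ?thesis by (simp add: poly_inner_def)
  qed
  then show ?case by (intro exI[of _ 0]) simp
next
  case (Suc n)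
  obtain r where r: "\<And>k. k \<ge> n \<Longrightarrow> coeff r k = 0"
    "\<And>q. (\<forall>k\<ge>n. coeff q k = 0) \<Longrightarrow> poly_inner \<mu> q (p - r) = 0"
    using Suc.IH[of p] by blast
  obtain s where s: "\<And>k. k \<ge> n \<Longrightarrow> coeff s k = 0"
    "\<And>q. (\<forall>k\<ge>n. coeff q k = 0) \<Longrightarrow> poly_inner \<mu> q (monom 1 n - s) = 0"
    using Suc.IH[of "monom 1 n"] by blast
  define e where "e = monom 1 n - s"
  have e: "coeff e n = 1" "\<And>k. k > n \<Longrightarrow> coeff e k = 0" using s(1) by (auto simp: e_def)
  then have "e \<noteq> 0" by auto
  then have ee: "poly_inner \<mu> e e \<noteq> 0" using poly_inner_self_eq_0_iff[OF atoms] by simp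
  define c where "c = cnj (poly_inner \<mu> e (p - r) / poly_inner \<mu> e e)"
  have ort_e: "poly_inner \<mu> e (p - (r + smult c e)) = 0"
  proof -
    have "p - (r + smult c e) = (p - r) + smult (- c) e" by simp
    then show ?thesis using ee
      by (simp only: poly_inner_add_right poly_inner_smult_right) (simp add: c_def)
  qed
  show ?case
  proof (intro exI[of _ "r + smult c e"] conjI allI impI)
    fix k assume "Suc n \<le> k"
    then show "coeff (r + smult c e) k = 0" using r(1) e(2) by simp
  next
    fix q :: "complex poly" assume q: "\<forall>k\<ge>Suc n. coeff q k = 0"
    define q' where "q' = q - smult (coeff q n) e"
    have "\<forall>k\<ge>n. coeff q' k = 0"
    proof (intro allI impI)
      fix k assume "n \<le> k"
      then show "coeff q' k = 0" using q e by (cases "k = n") (auto simp: q'_def)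
    qed
    then have "poly_inner \<mu> q' (p - r) = 0" "poly_inner \<mu> q' e = 0"
      using r(2) s(2) by (auto simp: e_def)
    moreover have "p - (r + smult c e) = (p - r) + smult (- c) e" by simp
    ultimately have "poly_inner \<mu> q' (p - (r + smult c e)) = 0"
      by (simp only: poly_inner_add_right poly_inner_smult_right) simp
    moreover have "q = q' + smult (coeff q n) e" by (simp add: q'_def)
    ultimately show "poly_inner \<mu> q (p - (r + smult c e)) = 0"
      using ort_e by (metis add_0 mult_zero_right poly_inner_add_left poly_inner_smult_left)
  qed
qed

lemma monic_polys_iff: "p \<in> monic_polys n \<longleftrightarrow> coeff p n = 1 \<and> (\<forall>k>n. coeff p k = 0)"
proof
  assume "coeff p n = 1 \<and> (\<forall>k>n. coeff p k = 0)"
  moreover from this have "degree p = n"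
    by (metis antisym degree_le le_degree zero_neq_one)
  ultimately show "p \<in> monic_polys n" by (auto simp: monic_polys_def)
qed (auto simp: monic_polys_def coeff_eq_0)

text \<open>
  The minimizing monic polynomial exists and is unique: it is \<open>z\<^sup>n\<close> minus its projection to lower degrees. This
  needs that no nonzero polynomial vanishes almost everywhere, which is ensured by the absence of atoms.
\<close>

theorem monic_orth_poly:
  assumes atoms: "\<And>a. emeasure \<mu> {a} = 0"
  shows "monic_orth_poly n \<mu> \<in> monic_polys n" (is ?monic)
    and "Q \<in> monic_polys n \<Longrightarrow> L2_poly_norm \<mu> (monic_orth_poly n \<mu>) \<le> L2_poly_norm \<mu> Q"
proof -
  obtain r where r: "\<And>k. k \<ge> n \<Longrightarrow> coeff r k = 0"
    "\<And>q. (\<forall>k\<ge>n. coeff q k = 0) \<Longrightarrow> poly_inner \<mu> q (monom 1 n - r) = 0"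
    using orthogonal_projection[OF atoms, of n "monom 1 n"] by blast
  define P where "P = monom 1 n - r"
  have P: "P \<in> monic_polys n" using r(1) by (simp add: monic_polys_iff P_def)
  have pyth: "(L2_poly_norm \<mu> Q)\<^sup>2 = (L2_poly_norm \<mu> P)\<^sup>2 + (L2_poly_norm \<mu> (Q - P))\<^sup>2"
    if Q: "Q \<in> monic_polys n" for Q
  proof -
    have "\<forall>k\<ge>n. coeff (Q - P) k = 0"
      using P Q by (auto simp: monic_polys_iff le_less)
    then have "poly_inner \<mu> (Q - P) P = 0" using r(2) by (auto simp: P_def)
    then show ?thesis using poly_inner_pythagoras[of "Q - P" P] by simp
  qed
  have le: "L2_poly_norm \<mu> P \<le> L2_poly_norm \<mu> Q" if Q: "Q \<in> monic_polys n" for Q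
    by (rule power2_le_imp_le) (simp_all add: pyth[OF Q] L2_poly_norm_nonneg)
  have inf: "(INF Q\<in>monic_polys n. L2_poly_norm \<mu> Q) = L2_poly_norm \<mu> P"
    using le P by (intro cInf_eq_minimum) auto
  have "monic_orth_poly n \<mu> = P"
    unfolding monic_orth_poly_def inf
  proof (rule the_equality)
    show "P \<in> monic_polys n \<and> L2_poly_norm \<mu> P = L2_poly_norm \<mu> P" using P by simp
    fix Q assume Q: "Q \<in> monic_polys n \<and> L2_poly_norm \<mu> Q = L2_poly_norm \<mu> P"
    then have "(L2_poly_norm \<mu> (Q - P))\<^sup>2 = 0" using pyth[of Q] by simp
    then have "poly_inner \<mu> (Q - P) (Q - P) = 0"
      unfolding L2_poly_norm_sq by (simp add: poly_inner_self)
    then show "Q = P" using poly_inner_self_eq_0_iff[OF atoms] by simp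
  qed
  then show ?monic "Q \<in> monic_polys n \<Longrightarrow> L2_poly_norm \<mu> (monic_orth_poly n \<mu>) \<le> L2_poly_norm \<mu> Q"
    using P le by auto
qed

text \<open>Jensen's inequality for \<open>exp\<close>, by integrating its tangent at the mean \<open>m\<close> of \<open>ln \<bar>P\<bar>\<close>.\<close>

lemma monic_L2_norm_ge:
  assumes atoms: "\<And>a. emeasure \<mu> {a} = 0"
    and int: "\<And>z. integrable \<mu> (\<lambda>w. ln (cmod (z - w)))"
    and ge: "\<And>z. - V \<le> log_potential \<mu> z"
    and P: "P \<in> monic_polys n"
  shows "exp (- V) ^ n \<le> L2_poly_norm \<mu> P"
proof -
  interpret prob_space \<mu> using prob_measures_onD[OF \<mu>] by auto
  have P': "degree P = n" "lead_coeff P = 1" "P \<noteq> 0" using P by (auto simp: monic_polys_def)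
  obtain As where As: "size As = n" "P = (\<Prod>a\<in>#As. [:-a, 1:])"
    using alg_closed_imp_factorization[OF P'(3)] P' by auto
  define L where "L w = (\<Sum>a\<in>#As. ln (cmod (a - w)))" for w
  have ln_P: "ln (cmod (poly P w)) = L w" if "poly P w \<noteq> 0" for w
  proof -
    have "poly (\<Prod>a\<in>#B. [:-a, 1:]) w \<noteq> 0 \<Longrightarrow>
        ln (cmod (poly (\<Prod>a\<in>#B. [:-a, 1:]) w)) = (\<Sum>a\<in>#B. ln (cmod (a - w)))" for B
    proof (induction B)
      case (add a B)
      have eq: "poly (\<Prod>a\<in>#add_mset a B. [:-a, 1:]) w = (w - a) * poly (\<Prod>a\<in>#B. [:-a, 1:]) w"
        by (simp add: algebra_simps)
      moreover from this have "w \<noteq> a" "poly (\<Prod>a\<in>#B. [:-a, 1:]) w \<noteq> 0" using add.prems by auto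
      ultimately show ?case using add.IH
        by (simp only: eq norm_mult) (simp add: ln_mult norm_minus_commute)
    qed simp
    then show ?thesis using that by (simp add: As(2) L_def)
  qed
  have int_sum: "integrable \<mu> (\<lambda>w. (\<Sum>a\<in>#B. ln (cmod (a - w))))"
    "(LINT w|\<mu>. (\<Sum>a\<in>#B. ln (cmod (a - w)))) = (\<Sum>a\<in>#B. log_potential \<mu> a)" for B
    by (induction B) (simp_all add: int log_potential_def)
  define m where "m = (LINT w|\<mu>. L w)"
  have intL: "integrable \<mu> L" using int_sum(1) by (simp add: L_def[abs_def])
  have "(\<Sum>a\<in>#B. - V) \<le> (\<Sum>a\<in>#B. log_potential \<mu> a)" for B
    using ge by (intro sum_mset_mono) auto
  from this[of As] have m: "- V * n \<le> m"
    unfolding m_def L_def int_sum(2) using As(1) by (simp add: mult.commute)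
  have "exp (2 * m) = (LINT w|\<mu>. exp (2 * m) * (1 + 2 * L w - 2 * m))"
    using intL by (simp add: prob_space m_def)
  also have "\<dots> \<le> (LINT w|\<mu>. (cmod (poly P w))\<^sup>2)"
  proof (rule integral_mono_AE)
    show "integrable \<mu> (\<lambda>w. exp (2 * m) * (1 + 2 * L w - 2 * m))" using intL by auto
    have "exp (2 * m) * (1 + 2 * L w - 2 * m) \<le> (cmod (poly P w))\<^sup>2" if w: "poly P w \<noteq> 0" for w
    proof -
      have "exp (2 * m) * (1 + 2 * L w - 2 * m) \<le> exp (2 * m) * exp (2 * L w - 2 * m)"
      proof (rule mult_left_mono)
        show "1 + 2 * L w - 2 * m \<le> exp (2 * L w - 2 * m)"
          using exp_ge_add_one_self[of "2 * L w - 2 * m"] by linarith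
      qed simp
      also have "\<dots> = exp (2 * L w)" by (simp flip: exp_add)
      also have "\<dots> = exp (L w) ^ 2" by (rule exp_double)
      also have "exp (L w) = cmod (poly P w)" using w by (simp flip: ln_P)
      finally show ?thesis .
    qed
    then show "AE w in \<mu>. exp (2 * m) * (1 + 2 * L w - 2 * m) \<le> (cmod (poly P w))\<^sup>2"
      using AE_poly_nonzero[OF P'(3) atoms] by (auto elim!: eventually_mono)
  qed (rule integrable_poly_sq)
  finally have "(exp m)\<^sup>2 \<le> (LINT w|\<mu>. (cmod (poly P w))\<^sup>2)" by (simp add: exp_double)
  then have "exp m \<le> L2_poly_norm \<mu> P"
    unfolding L2_poly_norm_def by (rule real_le_rsqrt)
  moreover have "exp (- V) ^ n \<le> exp m" using m by (simp flip: exp_of_nat_mult add: mult.commute)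
  ultimately show ?thesis by simp
qed

end

theorem widom_factor_ge_1:
  assumes K: "compact K" "non_polar K" "is_equilibrium_measure K \<mu>"
  shows "1 \<le> widom_factor n \<mu>"
proof -
  have \<mu>: "\<mu> \<in> prob_measures_on K" using K(3) by (simp add: is_equilibrium_measure_def)
  obtain V where V: "robin_constant K = ereal V" "\<And>a. emeasure \<mu> {a} = 0"
    "\<And>z. integrable \<mu> (\<lambda>w. ln (cmod (z - w)))" "\<And>z. - V \<le> log_potential \<mu> z"
    using frostman[OF K(3,1,2)] by blast
  have cap: "capacity (msupport \<mu>) = exp (- V)"
    by (simp add: capacity_def robin_constant_msupport[OF K(3,1)] V(1))
  have "exp (- V) ^ n \<le> L2_poly_norm \<mu> (monic_orth_poly n \<mu>)"
    by (rule monic_L2_norm_ge[OF \<mu> K(1) V(2-4) monic_orth_poly(1)[OF \<mu> K(1) V(2)]])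
  then show ?thesis
    by (simp add: widom_factor_def cap)
qed

section \<open>Energy and moments on the unit circle\<close>

text \<open>The term for \<open>n = 0\<close> is 0, since it has the denominator 0; the same holds in the later series.\<close>

lemma ln_cmod_one_minus_sums:
  assumes "cmod u < 1"
  shows "(\<lambda>n. Re (u ^ n / of_nat n)) sums (- ln (cmod (1 - u)))"
proof -
  have "1 - u \<noteq> 0" using assms by auto
  have "(\<lambda>n. - ((- (- u)) ^ n) / of_nat n) sums Ln (1 + - u)"
    using assms by (intro Ln_series') simp
  then have "(\<lambda>n. - (- (u ^ n) / of_nat n)) sums (- Ln (1 - u))"
    by (intro sums_minus) simp
  then have "(\<lambda>n. Re (- (- (u ^ n) / of_nat n))) sums Re (- Ln (1 - u))"
    by (rule bounded_linear.sums[OF bounded_linear_Re])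
  then show ?thesis using \<open>1 - u \<noteq> 0\<close> by simp
qed

text \<open>
  The potential of the image of \<open>\<nu>\<close> under the dilation by \<open>r < 1\<close>, with the sign of the energy. On the unit
  circle its kernel is bounded, and it approximates the potential of \<open>\<nu>\<close> as \<open>r\<close> tends to 1.
\<close>

definition dilated_potential :: "complex measure \<Rightarrow> real \<Rightarrow> complex \<Rightarrow> real" where
  "dilated_potential \<nu> r z = (LINT w|\<nu>. - ln (cmod (z - of_real r * w)))"

context
  fixes \<nu> :: "complex measure"
  assumes \<nu>: "\<nu> \<in> prob_measures_on unit_circle"
begin

lemma AE_unit_circle: "AE z in \<nu>. cmod z = 1"
  using prob_measures_on_AE[OF \<nu>] by simp

lemma integrable_on_circle:
  fixes f :: "complex \<Rightarrow> 'b::{banach, second_countable_topology}"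
  assumes "continuous_on UNIV f"
  shows "integrable \<nu> f"
  using assms by (intro integrable_prob_measures_on[OF \<nu> compact_sphere])
     (auto intro: borel_measurable_continuous_onI continuous_on_subset)

lemma power_series_integral:
  assumes c: "summable (\<lambda>n. cmod (c n))"
    and F: "\<And>z. cmod z = 1 \<Longrightarrow> (\<lambda>n. Re (c n * z ^ n)) sums F z" "F \<in> borel_measurable borel"
  shows "integrable \<nu> F" "(\<lambda>n. Re (c n * (LINT z|\<nu>. z ^ n))) sums (LINT z|\<nu>. F z)"
proof -
  interpret prob_space \<nu> using prob_measures_onD[OF \<nu>] by auto
  have Fm: "F \<in> borel_measurable \<nu>"
    using F(2) measurable_cong_sets[OF prob_measures_onD(2)[OF \<nu>] refl] by blast
  define f where "f n z = Re (c n * z ^ n)" for n z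
  have contf: "continuous_on UNIV (f n)" "continuous_on UNIV (\<lambda>z. norm (f n z))" for n
    unfolding f_def by (intro continuous_intros)+
  have bound: "\<bar>f n z\<bar> \<le> cmod (c n)" if "cmod z = 1" for n z
    using abs_Re_le_cmod[of "c n * z ^ n"] that by (simp add: f_def norm_mult norm_power)
  have f1: "integrable \<nu> (f n)" for n by (rule integrable_on_circle[OF contf(1)])
  have f2: "AE z in \<nu>. summable (\<lambda>n. norm (f n z))"
    using AE_unit_circle
    by eventually_elim (auto intro!: summable_comparison_test'[OF c, of 0] bound)
  have f3: "summable (\<lambda>n. LINT z|\<nu>. norm (f n z))"
  proof (rule summable_comparison_test'[OF c, of 0])
    fix n :: nat
    have "(LINT z|\<nu>. norm (f n z)) \<le> (LINT z|\<nu>. cmod (c n))"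
      using AE_unit_circle
      by (intro integral_mono_AE integrable_on_circle contf) (auto elim!: eventually_mono intro!: bound)
    then show "norm (LINT z|\<nu>. norm (f n z)) \<le> cmod (c n)"
      by (simp add: prob_space Bochner_Integration.integral_nonneg)
  qed
  have eq: "AE z in \<nu>. (\<Sum>n. f n z) = F z"
    using AE_unit_circle by eventually_elim (simp only: f_def sums_unique[OF F(1), symmetric])
  have "integrable \<nu> (\<lambda>z. \<Sum>n. f n z)" by (rule integrable_suminf[OF f1 f2 f3])
  then show "integrable \<nu> F"
    by (rule integrable_cong_AE_imp[OF _ Fm]) (use eq in auto)
  have "(\<lambda>n. LINT z|\<nu>. f n z) sums (LINT z|\<nu>. (\<Sum>n. f n z))"
    by (rule sums_integral[OF f1 f2 f3])
  also have "(LINT z|\<nu>. (\<Sum>n. f n z)) = (LINT z|\<nu>. F z)"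
    using f1 Fm eq by (intro integral_cong_AE) (auto intro: borel_measurable_suminf)
  also have "(\<lambda>n. LINT z|\<nu>. f n z) = (\<lambda>n. Re (c n * (LINT z|\<nu>. z ^ n)))"
  proof
    fix n
    have "integrable \<nu> (\<lambda>z. z ^ n)" by (intro integrable_on_circle continuous_intros)
    then have int: "integrable \<nu> (\<lambda>z. c n * z ^ n)" by simp
    have "(LINT z|\<nu>. f n z) = Re (LINT z|\<nu>. c n * z ^ n)"
      unfolding f_def by (rule integral_Re[OF int])
    then show "(LINT z|\<nu>. f n z) = Re (c n * (LINT z|\<nu>. z ^ n))" by simp
  qed
  finally show "(\<lambda>n. Re (c n * (LINT z|\<nu>. z ^ n))) sums (LINT z|\<nu>. F z)" .
qed

lemma circle_potential_sums:
  assumes r: "0 < r" "r < 1" and z: "cmod z = 1"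
  shows "integrable \<nu> (\<lambda>w. - ln (cmod (z - of_real r * w)))"
    "(\<lambda>n. Re (of_real (r ^ n) / of_nat n * cnj (LINT w|\<nu>. w ^ n) * z ^ n))
      sums (LINT w|\<nu>. - ln (cmod (z - of_real r * w)))"
proof -
  define c where "c n = (of_real r * cnj z) ^ n / of_nat n" for n
  have summ: "summable (\<lambda>n. cmod (c n))"
  proof (rule summable_comparison_test'[of "\<lambda>n. r ^ n" 1])
    show "norm (cmod (c n)) \<le> r ^ n" if "1 \<le> n" for n
      using r z that by (simp add: c_def norm_mult norm_divide norm_power power_mult_distrib field_simps)
  qed (use r in \<open>auto intro: summable_geometric\<close>)
  have ser: "(\<lambda>n. Re (c n * w ^ n)) sums (- ln (cmod (z - of_real r * w)))" if w: "cmod w = 1" for w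
  proof -
    have "cmod (of_real r * cnj z * w) < 1" using r z w by (simp add: norm_mult)
    from ln_cmod_one_minus_sums[OF this]
    have "(\<lambda>n. Re (c n * w ^ n)) sums (- ln (cmod (1 - of_real r * cnj z * w)))"
      by (simp add: c_def power_mult_distrib)
    moreover have "z * (1 - of_real r * cnj z * w) = z - of_real r * w"
      using z complex_norm_square[of z] by (simp add: algebra_simps)
    then have "cmod (1 - of_real r * cnj z * w) = cmod (z - of_real r * w)"
      using z by (metis mult_1 norm_mult)
    ultimately show ?thesis by simp
  qed
  have meas: "(\<lambda>w. - ln (cmod (z - of_real r * w))) \<in> borel_measurable borel" by measurable
  note * = power_series_integral[OF summ ser meas]
  show "integrable \<nu> (\<lambda>w. - ln (cmod (z - of_real r * w)))" by (rule *(1))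
  have "Re (c n * m) = Re (of_real (r ^ n) / of_nat n * cnj m * z ^ n)" for n m
  proof -
    have "cnj (c n * m) = of_real (r ^ n) / of_nat n * cnj m * z ^ n"
      by (simp add: c_def power_mult_distrib)
    then show ?thesis using complex_cnj_cnj cnj.simps(1) by metis
  qed
  then show "(\<lambda>n. Re (of_real (r ^ n) / of_nat n * cnj (LINT w|\<nu>. w ^ n) * z ^ n))
      sums (LINT w|\<nu>. - ln (cmod (z - of_real r * w)))"
    using *(2) by simp
qed

lemma moment_le_1: "cmod (LINT w|\<nu>. w ^ n) \<le> 1"
proof -
  interpret prob_space \<nu> using prob_measures_onD[OF \<nu>] by auto
  have "cmod (LINT w|\<nu>. w ^ n) \<le> (LINT w|\<nu>. cmod (w ^ n))" by (rule integral_norm_bound)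
  also have "\<dots> = (LINT w|\<nu>. 1)"
    using AE_unit_circle prob_measures_onD(2)[OF \<nu>]
    by (intro integral_cong_AE) (auto simp: norm_power elim!: eventually_mono)
  finally show ?thesis by (simp add: prob_space)
qed

lemma dilated_energy_sums:
  assumes r: "0 < r" "r < 1"
  shows "integrable \<nu> (dilated_potential \<nu> r)"
    "(\<lambda>n. r ^ n / n * (cmod (LINT w|\<nu>. w ^ n))\<^sup>2) sums (LINT z|\<nu>. dilated_potential \<nu> r z)"
proof -
  interpret prob_space \<nu> using prob_measures_onD[OF \<nu>] by auto
  define c where "c n = of_real (r ^ n) / of_nat n * cnj (LINT w|\<nu>. w ^ n)" for n
  have summ: "summable (\<lambda>n. cmod (c n))"
  proof (rule summable_comparison_test'[of "\<lambda>n. r ^ n" 1])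
    fix n :: nat assume n: "1 \<le> n"
    have "cmod (c n) = r ^ n / n * cmod (LINT w|\<nu>. w ^ n)"
      using r by (simp add: c_def norm_mult norm_divide norm_power)
    also have "\<dots> \<le> r ^ n / 1 * 1"
      using r n moment_le_1 by (intro mult_mono divide_left_mono) auto
    finally show "norm (cmod (c n)) \<le> r ^ n" by simp
  qed (use r in \<open>auto intro: summable_geometric\<close>)
  have ser: "(\<lambda>n. Re (c n * z ^ n)) sums dilated_potential \<nu> r z" if "cmod z = 1" for z
    unfolding c_def dilated_potential_def by (rule circle_potential_sums(2)[OF r that])
  have meas: "dilated_potential \<nu> r \<in> borel_measurable borel"
  proof -
    have "(\<lambda>(z, w). - ln (cmod (z - of_real r * w))) \<in> borel_measurable (borel \<Otimes>\<^sub>M borel)"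
      by measurable
    then have "(\<lambda>(z, w). - ln (cmod (z - of_real r * w))) \<in> borel_measurable (borel \<Otimes>\<^sub>M \<nu>)"
      using measurable_cong_sets[OF sets_pair_measure_cong[OF refl prob_measures_onD(2)[OF \<nu>]] refl] by blast
    then show ?thesis unfolding dilated_potential_def by (rule borel_measurable_lebesgue_integral)
  qed
  note * = power_series_integral[OF summ ser meas]
  show "integrable \<nu> (dilated_potential \<nu> r)" by (rule *(1))
  have "Re (c n * (LINT w|\<nu>. w ^ n)) = r ^ n / n * (cmod (LINT w|\<nu>. w ^ n))\<^sup>2" for n
  proof -
    have "c n * (LINT w|\<nu>. w ^ n) = of_real (r ^ n / n * (cmod (LINT w|\<nu>. w ^ n))\<^sup>2)"
      by (simp add: c_def complex_norm_square del: of_real_power)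
    then show ?thesis by simp
  qed
  then show "(\<lambda>n. r ^ n / n * (cmod (LINT w|\<nu>. w ^ n))\<^sup>2) sums (LINT z|\<nu>. dilated_potential \<nu> r z)"
    using *(2) by simp
qed

lemma dilated_kernel_nonneg:
  assumes "0 < r" "r < 1" "cmod z = 1" "cmod w = 1"
  shows "0 \<le> ln 2 - ln (cmod (z - of_real r * w))"
proof -
  have "cmod (z - of_real r * w) \<le> 2"
    using norm_triangle_ineq4[of z "of_real r * w"] assms by (simp add: norm_mult)
  moreover have "z \<noteq> of_real r * w" using assms by (auto simp: norm_mult)
  ultimately show ?thesis by simp
qed

lemma nn_integral_dilated_kernel:
  assumes r: "0 < r" "r < 1" and z: "cmod z = 1"
  shows "(\<integral>\<^sup>+w. ennreal (ln 2 - ln (cmod (z - of_real r * w))) \<partial>\<nu>) = ennreal (ln 2 + dilated_potential \<nu> r z)"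
    "0 \<le> ln 2 + dilated_potential \<nu> r z"
proof -
  interpret prob_space \<nu> using prob_measures_onD[OF \<nu>] by auto
  note int = circle_potential_sums(1)[OF r z]
  have int': "integrable \<nu> (\<lambda>w. ln 2 + - ln (cmod (z - of_real r * w)))"
    by (intro Bochner_Integration.integrable_add int) auto
  have nn: "AE w in \<nu>. 0 \<le> ln 2 + - ln (cmod (z - of_real r * w))"
    using AE_unit_circle by eventually_elim (use dilated_kernel_nonneg[OF r z] in simp)
  have eq: "(LINT w|\<nu>. ln 2 + - ln (cmod (z - of_real r * w))) = ln 2 + dilated_potential \<nu> r z"
    unfolding dilated_potential_def by (subst Bochner_Integration.integral_add[OF _ int]) (simp_all add: prob_space del: integral_minus)
  show "(\<integral>\<^sup>+w. ennreal (ln 2 - ln (cmod (z - of_real r * w))) \<partial>\<nu>) = ennreal (ln 2 + dilated_potential \<nu> r z)"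
    using nn_integral_eq_integral[OF int' nn] unfolding eq by simp
  show "0 \<le> ln 2 + dilated_potential \<nu> r z"
    unfolding eq[symmetric] by (rule integral_nonneg_AE[OF nn])
qed

text \<open>
  On the unit circle \<open>\<bar>z - r w\<bar>\<^sup>2 = (1 - r)\<^sup>2 + r \<bar>z - w\<bar>\<^sup>2 \<ge> r \<bar>z - w\<bar>\<^sup>2\<close>, which bounds the dilated kernel by the
  kernel itself up to an error that vanishes as \<open>r\<close> tends to 1.
\<close>

lemma dilated_kernel_le:
  assumes r: "0 < r" "r < 1" and zw: "cmod z = 1" "cmod w = 1"
  shows "ennreal (ln 2 - ln (cmod (z - of_real r * w))) \<le> shifted_kernel 2 z w + ennreal (- ln r / 2)"
proof (cases "z = w")
  case False
  have norm1: "(Re z)\<^sup>2 + (Im z)\<^sup>2 = 1" "(Re w)\<^sup>2 + (Im w)\<^sup>2 = 1"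
    using zw by (metis cmod_power2 one_power2)+
  have "(cmod (z - of_real r * w))\<^sup>2 - (1 - r)\<^sup>2 - r * (cmod (z - w))\<^sup>2
     = (1 - r) * ((Re z)\<^sup>2 + (Im z)\<^sup>2) + (r\<^sup>2 - r) * ((Re w)\<^sup>2 + (Im w)\<^sup>2) - (1 - r)\<^sup>2"
    unfolding cmod_power2 by (simp add: power2_eq_square algebra_simps)
  also have "\<dots> = 0" unfolding norm1 by (simp add: power2_eq_square algebra_simps)
  finally have "r * (cmod (z - w))\<^sup>2 \<le> (cmod (z - of_real r * w))\<^sup>2"
    using zero_le_power2[of "1 - r"] by linarith
  moreover have "z \<noteq> of_real r * w" using assms by (auto simp: norm_mult)
  ultimately have "ln (r * (cmod (z - w))\<^sup>2) \<le> ln ((cmod (z - of_real r * w))\<^sup>2)"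
    using r False by (subst ln_le_cancel_iff) auto
  then have "ln r + 2 * ln (cmod (z - w)) \<le> 2 * ln (cmod (z - of_real r * w))"
    using r False \<open>z \<noteq> of_real r * w\<close> by (simp add: ln_mult ln_realpow)
  then have le: "ln 2 - ln (cmod (z - of_real r * w)) \<le> (ln 2 - ln (cmod (z - w))) + - ln r / 2"
    by simp
  have "cmod (z - w) \<le> 2" using norm_triangle_ineq4[of z w] zw by simp
  then have "0 \<le> ln 2 - ln (cmod (z - w))" using False by simp
  then show ?thesis
    using False r ennreal_leI[OF le] by (subst (asm) ennreal_plus) (auto simp: shifted_kernel_eq)
qed (simp add: shifted_kernel_eq)

theorem log_energy_ge_moment:
  assumes n: "0 < n"
  shows "ereal ((cmod (LINT w|\<nu>. w ^ n))\<^sup>2 / n) \<le> log_energy \<nu>"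
proof -
  note \<nu>' = prob_measures_onD[OF \<nu>]
  interpret prob_space \<nu> using \<nu>' by auto
  have [measurable_cong, simp]: "sets \<nu> = sets borel" by (fact \<nu>')
  note [measurable] = measurable_shifted_potential[OF \<nu>'(2,1), of 2]
  define N where "N = (\<integral>\<^sup>+z. shifted_potential 2 \<nu> z \<partial>\<nu>)"
  define a where "a = (cmod (LINT w|\<nu>. w ^ n))\<^sup>2 / n"
  have energy: "log_energy \<nu> + ereal (ln 2) = enn2ereal N"
    unfolding N_def
  proof (rule log_energy_shifted[OF \<nu> compact_sphere])
    show "dist z w \<le> 2" if "z \<in> unit_circle" "w \<in> unit_circle" for z w
      using norm_triangle_ineq4[of z w] that by (simp add: dist_norm)
  qed simp
  have le: "ennreal (ln 2 + r ^ n * a) \<le> N + ennreal (- ln r / 2)" if r: "0 < r" "r < 1" for r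
  proof -
    note sums = dilated_energy_sums[OF r]
    have "r ^ n * a \<le> (LINT z|\<nu>. dilated_potential \<nu> r z)"
      using sum_le_suminf[OF sums_summable[OF sums(2)], of "{n}"] r
      unfolding sums_unique[OF sums(2), symmetric] by (simp add: a_def)
    then have "ennreal (ln 2 + r ^ n * a) \<le> ennreal (LINT z|\<nu>. ln 2 + dilated_potential \<nu> r z)"
      using sums(1) by (intro ennreal_leI) (simp add: prob_space)
    also have "\<dots> = (\<integral>\<^sup>+z. ennreal (ln 2 + dilated_potential \<nu> r z) \<partial>\<nu>)"
    proof (rule nn_integral_eq_integral[symmetric])
      show "AE z in \<nu>. 0 \<le> ln 2 + dilated_potential \<nu> r z"
        using AE_unit_circle by eventually_elim (rule nn_integral_dilated_kernel(2)[OF r])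
    qed (use sums(1) in auto)
    also have "\<dots> \<le> (\<integral>\<^sup>+z. shifted_potential 2 \<nu> z + ennreal (- ln r / 2) \<partial>\<nu>)"
    proof (rule nn_integral_mono_AE)
      have "ennreal (ln 2 + dilated_potential \<nu> r z) \<le> shifted_potential 2 \<nu> z + ennreal (- ln r / 2)"
        if z: "cmod z = 1" for z
      proof -
        have "ennreal (ln 2 + dilated_potential \<nu> r z) \<le> (\<integral>\<^sup>+w. shifted_kernel 2 z w + ennreal (- ln r / 2) \<partial>\<nu>)"
          unfolding nn_integral_dilated_kernel(1)[OF r z, symmetric]
          using AE_unit_circle by (intro nn_integral_mono_AE) (erule eventually_mono, rule dilated_kernel_le[OF r z])
        also have "\<dots> = shifted_potential 2 \<nu> z + ennreal (- ln r / 2)"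
          unfolding shifted_potential_def by (subst nn_integral_add) (auto simp: emeasure_space_1)
        finally show ?thesis .
      qed
      then show "AE z in \<nu>. ennreal (ln 2 + dilated_potential \<nu> r z) \<le> shifted_potential 2 \<nu> z + ennreal (- ln r / 2)"
        using AE_unit_circle by (auto elim!: eventually_mono)
    qed
    also have "\<dots> = N + ennreal (- ln r / 2)"
      unfolding N_def by (subst nn_integral_add) (auto simp: emeasure_space_1)
    finally show ?thesis .
  qed
  show ?thesis
  proof (cases N)
    case (real x)
    have le': "ln 2 + r ^ n * a \<le> x + - ln r / 2" if r: "0 < r" "r < 1" for r
    proof -
      have "0 \<le> x + - ln r / 2" using real ln_le_zero_iff[of r] r by linarith
      then have "ln 2 + r ^ n * a \<le> x + - ln r / 2 \<longleftrightarrow> ennreal (ln 2 + r ^ n * a) \<le> ennreal (x + - ln r / 2)"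
        by (subst ennreal_le_iff) auto
      moreover have "ennreal (x + - ln r / 2) = ennreal x + ennreal (- ln r / 2)"
        using real r by (intro ennreal_plus) auto
      ultimately show ?thesis using le[OF r] real by simp
    qed
    have "((\<lambda>r. ln 2 + r ^ n * a) \<longlongrightarrow> ln 2 + 1 ^ n * a) (at_left 1)"
      by (intro tendsto_intros)
    moreover have "((\<lambda>r. x + - ln r / 2) \<longlongrightarrow> x + - ln 1 / 2) (at_left 1)"
      by (intro tendsto_intros) auto
    moreover have "eventually (\<lambda>r. ln 2 + r ^ n * a \<le> x + - ln r / 2) (at_left (1::real))"
      by (rule eventually_mono[OF eventually_at_left_real[OF zero_less_one]]) (use le' in auto)
    ultimately have "ln 2 + 1 ^ n * a \<le> x + - ln 1 / 2"
      by (intro tendsto_le[OF trivial_limit_at_left_real])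
    then show ?thesis
      using energy real by (cases "log_energy \<nu>") (auto simp: a_def enn2ereal_ennreal)
  next
    case top
    then show ?thesis using energy by (cases "log_energy \<nu>") auto
  qed
qed

text \<open>All dilated potentials vanish on the circle, and Fatou's lemma passes to the limit as \<open>r\<close> tends to 1.\<close>

lemma log_energy_le_0_if_moments_vanish:
  assumes m: "\<And>n. 0 < n \<Longrightarrow> (LINT w|\<nu>. w ^ n) = 0"
  shows "log_energy \<nu> \<le> 0"
proof -
  note \<nu>' = prob_measures_onD[OF \<nu>]
  interpret prob_space \<nu> using \<nu>' by auto
  have [measurable_cong, simp]: "sets \<nu> = sets borel" by (fact \<nu>')
  define N where "N = (\<integral>\<^sup>+z. shifted_potential 2 \<nu> z \<partial>\<nu>)"
  have energy: "log_energy \<nu> + ereal (ln 2) = enn2ereal N"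
    unfolding N_def
  proof (rule log_energy_shifted[OF \<nu> compact_sphere])
    show "dist z w \<le> 2" if "z \<in> unit_circle" "w \<in> unit_circle" for z w
      using norm_triangle_ineq4[of z w] that by (simp add: dist_norm)
  qed simp
  define r where "r i = 1 - inverse (real (Suc (Suc i)))" for i
  have r: "0 < r i" "r i < 1" for i by (auto simp: r_def field_simps)
  have "(\<lambda>i. inverse (real (Suc (Suc i)))) \<longlonglongrightarrow> 0"
    using LIMSEQ_inverse_real_of_nat by (rule LIMSEQ_Suc)
  then have r_lim: "r \<longlonglongrightarrow> 1"
    unfolding r_def[abs_def] using tendsto_diff[OF tendsto_const, of _ 0 sequentially "1::real"] by simp
  have dil0: "dilated_potential \<nu> (r i) z = 0" if z: "cmod z = 1" for i z
  proof -
    have "(\<lambda>n. Re (of_real (r i ^ n) / of_nat n * cnj (LINT w|\<nu>. w ^ n) * z ^ n)) = (\<lambda>n. 0)"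
    proof
      show "Re (of_real (r i ^ n) / of_nat n * cnj (LINT w|\<nu>. w ^ n) * z ^ n) = 0" for n
        using m[of n] by (cases "n = 0") auto
    qed
    with circle_potential_sums(2)[OF r z, of i] have "(\<lambda>n. 0) sums dilated_potential \<nu> (r i) z"
      by (simp only: dilated_potential_def)
    then show ?thesis using sums_unique2[OF _ sums_zero] by blast
  qed
  have pot: "shifted_potential 2 \<nu> z \<le> ennreal (ln 2)" if z: "cmod z = 1" for z
  proof -
    have lim: "shifted_kernel 2 z w \<le> liminf (\<lambda>i. ennreal (ln 2 - ln (cmod (z - of_real (r i) * w))))" for w
    proof (cases "z = w")
      case True
      have "cmod (z - of_real (r i) * w) = inverse (real (Suc (Suc i)))" for i
      proof -
        have "z - of_real (r i) * w = of_real (inverse (real (Suc (Suc i)))) * z"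
          using True by (simp add: r_def algebra_simps)
        then show ?thesis using z by (simp only: norm_mult norm_of_real) simp
      qed
      moreover have "filterlim (\<lambda>i. ln 2 - ln (inverse (real (Suc (Suc i))))) at_top sequentially"
      proof -
        have "filterlim (\<lambda>i. real (Suc (Suc i))) at_top sequentially"
          by (intro filterlim_compose[OF filterlim_real_sequentially]
              filterlim_compose[OF filterlim_Suc] filterlim_Suc)
        from filterlim_tendsto_add_at_top[OF tendsto_const filterlim_compose[OF ln_at_top this]]
        show ?thesis by (simp add: ln_inverse)
      qed
      then have "(\<lambda>i. ennreal (ln 2 - ln (inverse (real (Suc (Suc i)))))) \<longlonglongrightarrow> \<infinity>"
        by (simp add: ennreal_tendsto_top_eq_at_top)
      ultimately have "(\<lambda>i. ennreal (ln 2 - ln (cmod (z - of_real (r i) * w)))) \<longlonglongrightarrow> \<infinity>" by simp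
      then have "liminf (\<lambda>i. ennreal (ln 2 - ln (cmod (z - of_real (r i) * w)))) = \<infinity>"
        by (rule lim_imp_Liminf[OF sequentially_bot])
      then show ?thesis by simp
    next
      case False
      have "(\<lambda>i. ennreal (ln 2 - ln (cmod (z - of_real (r i) * w)))) \<longlonglongrightarrow> ennreal (ln 2 - ln (cmod (z - of_real 1 * w)))"
        using False by (intro tendsto_ennrealI tendsto_intros r_lim) auto
      then have "liminf (\<lambda>i. ennreal (ln 2 - ln (cmod (z - of_real (r i) * w)))) = ennreal (ln 2 - ln (cmod (z - of_real 1 * w)))"
        by (rule lim_imp_Liminf[OF sequentially_bot])
      then show ?thesis using False by (simp add: shifted_kernel_eq)
    qed
    have "shifted_potential 2 \<nu> z \<le> (\<integral>\<^sup>+w. liminf (\<lambda>i. ennreal (ln 2 - ln (cmod (z - of_real (r i) * w)))) \<partial>\<nu>)"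
      unfolding shifted_potential_def by (intro nn_integral_mono lim)
    also have "\<dots> \<le> liminf (\<lambda>i. \<integral>\<^sup>+w. ennreal (ln 2 - ln (cmod (z - of_real (r i) * w))) \<partial>\<nu>)"
      by (rule nn_integral_liminf) measurable
    also have "\<dots> = ennreal (ln 2)"
      unfolding nn_integral_dilated_kernel(1)[OF r z] dil0[OF z] by (simp add: Liminf_const)
    finally show ?thesis .
  qed
  have "N \<le> (\<integral>\<^sup>+z. ennreal (ln 2) \<partial>\<nu>)"
    unfolding N_def using AE_unit_circle by (intro nn_integral_mono_AE) (auto elim!: eventually_mono intro: pot)
  then have "N \<le> ennreal (ln 2)" by (simp add: emeasure_space_1)
  then have "enn2ereal N \<le> ereal (ln 2)" by (simp add: less_eq_ennreal.rep_eq enn2ereal_ennreal)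
  then have "log_energy \<nu> + ereal (ln 2) \<le> ereal (ln 2)" unfolding energy .
  then show ?thesis by (cases "log_energy \<nu>") auto
qed

end

section \<open>Measures on the circle are determined by their moments\<close>

lemma borel_measurable_cnj [measurable]: "cnj \<in> borel_measurable borel"
  by (intro borel_measurable_continuous_onI continuous_intros)

lemma moment_cnj_mult:
  assumes \<nu>: "\<nu> \<in> prob_measures_on unit_circle"
  shows "(LINT z|\<nu>. cnj z ^ n * z ^ k)
    = (if n \<le> k then (LINT z|\<nu>. z ^ (k - n)) else cnj (LINT z|\<nu>. z ^ (n - k)))"
proof -
  have [measurable_cong]: "sets \<nu> = sets borel" by (rule prob_measures_onD[OF \<nu>])
  have unit: "cnj z * z = 1" if "cmod z = 1" for z
    using complex_norm_square[of z] that by (simp add: mult.commute)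
  show ?thesis
  proof (cases "n \<le> k")
    case True
    have "cnj z ^ n * z ^ k = z ^ (k - n)" if "cmod z = 1" for z
    proof -
      have "cnj z ^ n * z ^ k = (cnj z * z) ^ n * z ^ (k - n)"
        using True by (simp add: power_mult_distrib flip: power_add)
      then show ?thesis using unit[OF that] by simp
    qed
    then have "(LINT z|\<nu>. cnj z ^ n * z ^ k) = (LINT z|\<nu>. z ^ (k - n))"
      using AE_unit_circle[OF \<nu>] by (intro integral_cong_AE) (auto elim!: eventually_mono)
    then show ?thesis using True by simp
  next
    case False
    have "cnj z ^ n * z ^ k = cnj (z ^ (n - k))" if "cmod z = 1" for z
    proof -
      have "cnj z ^ n * z ^ k = (cnj z * z) ^ k * cnj z ^ (n - k)"
        using False by (simp add: power_mult_distrib mult.assoc mult.commute flip: power_add)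
      then show ?thesis using unit[OF that] by simp
    qed
    then have "(LINT z|\<nu>. cnj z ^ n * z ^ k) = (LINT z|\<nu>. cnj (z ^ (n - k)))"
      using AE_unit_circle[OF \<nu>] by (intro integral_cong_AE) (auto elim!: eventually_mono)
    also have "\<dots> = cnj (LINT z|\<nu>. z ^ (n - k))"
      by (intro integral_bounded_linear bounded_linear_cnj integrable_on_circle[OF \<nu>] continuous_intros)
    finally show ?thesis using False by simp
  qed
qed

text \<open>
  On the unit circle a real polynomial function is a trigonometric polynomial, here a complex polynomial divided by a
  power of \<open>z\<close>: \<open>z Re z = (z\<^sup>2 + 1) / 2\<close> and \<open>z Im z = (z\<^sup>2 - 1) / (2 \<i>)\<close>.
\<close>

lemma real_polynomial_function_on_circle:
  assumes "real_polynomial_function f"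
  shows "\<exists>n p. \<forall>z. cmod z = 1 \<longrightarrow> z ^ n * complex_of_real (f z) = poly p z"
  using assms
proof (induction rule: real_polynomial_function.induct)
  case (linear f)
  interpret bounded_linear f by fact
  have "z ^ 1 * complex_of_real (f z)
      = poly [:(of_real (f 1) + \<i> * of_real (f \<i>)) / 2, 0, (of_real (f 1) - \<i> * of_real (f \<i>)) / 2:] z"
    if z: "cmod z = 1" for z
  proof -
    have "z * cnj z = 1" using complex_norm_square[of z] z by simp
    then have re: "z * of_real (Re z) = (z ^ 2 + 1) / 2" and im: "z * of_real (Im z) = - \<i> * (z ^ 2 - 1) / 2"
      by (auto simp: complex_eq_iff power2_eq_square algebra_simps)
    have "f z = f (Re z *\<^sub>R 1 + Im z *\<^sub>R \<i>)"
      by (rule arg_cong[of _ _ f]) (simp add: complex_eq_iff)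
    also have "\<dots> = Re z * f 1 + Im z * f \<i>" by (simp only: add scale real_scaleR_def)
    finally have "z ^ 1 * complex_of_real (f z)
        = (z * of_real (Re z)) * of_real (f 1) + (z * of_real (Im z)) * of_real (f \<i>)"
      by (simp add: algebra_simps)
    also have "\<dots> = (z ^ 2 + 1) / 2 * of_real (f 1) + (- \<i> * (z ^ 2 - 1) / 2) * of_real (f \<i>)"
      by (simp only: re im)
    also have "\<dots> = poly [:(of_real (f 1) + \<i> * of_real (f \<i>)) / 2, 0, (of_real (f 1) - \<i> * of_real (f \<i>)) / 2:] z"
      by (simp add: field_simps power2_eq_square)
    finally show ?thesis .
  qed
  then show ?case by blast
next
  case (const c)
  show ?case by (intro exI[of _ 0] exI[of _ "[:of_real c:]"]) simp
next
  case (add f g)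
  then obtain n p m q where *: "\<forall>z. cmod z = 1 \<longrightarrow> z ^ n * complex_of_real (f z) = poly p z"
    "\<forall>z. cmod z = 1 \<longrightarrow> z ^ m * complex_of_real (g z) = poly q z" by blast
  have "z ^ (n + m) * complex_of_real (f z + g z) = poly (monom 1 m * p + monom 1 n * q) z" if "cmod z = 1" for z
    using *[rule_format, OF that] by (simp add: power_add poly_monom algebra_simps flip: *[rule_format, OF that])
  then show ?case by blast
next
  case (mult f g)
  then obtain n p m q where *: "\<forall>z. cmod z = 1 \<longrightarrow> z ^ n * complex_of_real (f z) = poly p z"
    "\<forall>z. cmod z = 1 \<longrightarrow> z ^ m * complex_of_real (g z) = poly q z" by blast
  have "z ^ (n + m) * complex_of_real (f z * g z) = poly (p * q) z" if "cmod z = 1" for z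
    using that by (simp add: power_add algebra_simps flip: *[rule_format, OF that])
  then show ?case by blast
qed

text \<open>By the Stone-Weierstrass theorem on the circle.\<close>

lemma integral_eq_if_moments_eq:
  assumes \<mu>: "\<mu> \<in> prob_measures_on unit_circle" and \<nu>: "\<nu> \<in> prob_measures_on unit_circle"
    and moments: "\<And>n. (LINT z|\<mu>. z ^ n) = (LINT z|\<nu>. z ^ n)"
    and f: "continuous_on UNIV (f :: complex \<Rightarrow> real)"
  shows "(LINT z|\<mu>. f z) = (LINT z|\<nu>. f z)"
proof (rule ccontr)
  assume neq: "(LINT z|\<mu>. f z) \<noteq> (LINT z|\<nu>. f z)"
  define e where "e = \<bar>(LINT z|\<mu>. f z) - (LINT z|\<nu>. f z)\<bar> / 3"
  have e: "e > 0" using neq by (simp add: e_def)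
  obtain g where g: "real_polynomial_function g" "\<And>z. z \<in> unit_circle \<Longrightarrow> \<bar>f z - g z\<bar> < e"
    using Stone_Weierstrass_real_polynomial_function[OF compact_sphere continuous_on_subset[OF f] e, of 0 1] by auto
  have contg: "continuous_on UNIV g"
    using g(1) by (intro continuous_at_imp_continuous_on ballI continuous_real_polymonial_function)
  obtain n p where np: "\<And>z. cmod z = 1 \<Longrightarrow> z ^ n * complex_of_real (g z) = poly p z"
    using real_polynomial_function_on_circle[OF g(1)] by blast
  have g_eq: "complex_of_real (LINT z|\<rho>. g z) = (\<Sum>k\<le>degree p. coeff p k * (LINT z|\<rho>. cnj z ^ n * z ^ k))"
    if \<rho>: "\<rho> \<in> prob_measures_on unit_circle" for \<rho>
  proof -
    have [measurable_cong]: "sets \<rho> = sets borel" by (rule prob_measures_onD[OF \<rho>])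
    have [measurable]: "g \<in> borel_measurable borel" using contg by (rule borel_measurable_continuous_onI)
    have eq: "complex_of_real (g z) = (\<Sum>k\<le>degree p. coeff p k * (cnj z ^ n * z ^ k))" if z: "cmod z = 1" for z
    proof -
      have "cnj z * z = 1" using complex_norm_square[of z] z by (simp add: mult.commute)
      then have "complex_of_real (g z) = (cnj z * z) ^ n * complex_of_real (g z)" by simp
      also have "\<dots> = cnj z ^ n * poly p z"
        unfolding np[OF z, symmetric] by (simp add: power_mult_distrib mult.assoc)
      also have "\<dots> = (\<Sum>k\<le>degree p. coeff p k * (cnj z ^ n * z ^ k))"
        by (simp add: poly_altdef sum_distrib_left mult_ac)
      finally show ?thesis .
    qed
    have "complex_of_real (LINT z|\<rho>. g z) = (LINT z|\<rho>. complex_of_real (g z))" by simp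
    also have "\<dots> = (LINT z|\<rho>. (\<Sum>k\<le>degree p. coeff p k * (cnj z ^ n * z ^ k)))"
      using AE_unit_circle[OF \<rho>] by (intro integral_cong_AE) (auto elim!: eventually_mono intro: eq)
    also have "\<dots> = (\<Sum>k\<le>degree p. (LINT z|\<rho>. coeff p k * (cnj z ^ n * z ^ k)))"
      by (intro Bochner_Integration.integral_sum integrable_on_circle[OF \<rho>] continuous_intros)
    finally show ?thesis by simp
  qed
  have "complex_of_real (LINT z|\<mu>. g z) = complex_of_real (LINT z|\<nu>. g z)"
    unfolding g_eq[OF \<mu>] g_eq[OF \<nu>] moment_cnj_mult[OF \<mu>] moment_cnj_mult[OF \<nu>] moments ..
  then have gg: "(LINT z|\<mu>. g z) = (LINT z|\<nu>. g z)" by (simp only: of_real_eq_iff)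
  have close: "\<bar>(LINT z|\<rho>. f z) - (LINT z|\<rho>. g z)\<bar> \<le> e" if \<rho>: "\<rho> \<in> prob_measures_on unit_circle" for \<rho>
  proof -
    interpret prob_space \<rho> using prob_measures_onD[OF \<rho>] by auto
    note int = integrable_on_circle[OF \<rho> f] integrable_on_circle[OF \<rho> contg]
    have "\<bar>(LINT z|\<rho>. f z) - (LINT z|\<rho>. g z)\<bar> = \<bar>LINT z|\<rho>. f z - g z\<bar>"
      by (simp add: int)
    also have "\<dots> \<le> (LINT z|\<rho>. \<bar>f z - g z\<bar>)" by (rule integral_abs_bound)
    also have "\<dots> \<le> (LINT z|\<rho>. e)"
      using AE_unit_circle[OF \<rho>] int
      by (intro integral_mono_AE) (auto elim!: eventually_mono intro!: less_imp_le[OF g(2)])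
    finally show ?thesis by (simp add: prob_space)
  qed
  have "\<bar>(LINT z|\<mu>. f z) - (LINT z|\<nu>. f z)\<bar> = 3 * e" by (simp add: e_def)
  then show False using close[OF \<mu>] close[OF \<nu>] gg e by linarith
qed

lemma measure_closed_limit:
  assumes \<nu>: "\<nu> \<in> prob_measures_on unit_circle" and C: "closed C" "C \<noteq> {}"
  shows "(\<lambda>n. LINT z|\<nu>. max 0 (1 - real n * infdist z C)) \<longlonglongrightarrow> measure \<nu> C"
proof -
  interpret prob_space \<nu> using prob_measures_onD[OF \<nu>] by auto
  have [measurable_cong, simp]: "sets \<nu> = sets borel" by (fact prob_measures_onD[OF \<nu>])
  have "(\<lambda>n. LINT z|\<nu>. max 0 (1 - real n * infdist z C)) \<longlonglongrightarrow> (LINT z|\<nu>. indicator C z)"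
  proof (rule integral_dominated_convergence[where w="\<lambda>_. 1"])
    show "AE z in \<nu>. (\<lambda>n. max 0 (1 - real n * infdist z C)) \<longlonglongrightarrow> indicator C z"
    proof (rule AE_I2)
      fix z
      show "(\<lambda>n. max 0 (1 - real n * infdist z C)) \<longlonglongrightarrow> indicator C z"
      proof (cases "z \<in> C")
        case False
        then have "infdist z C > 0"
          using in_closed_iff_infdist_zero[OF C] infdist_nonneg[of z C] by (simp add: less_le)
        then obtain N where N: "real N * infdist z C > 1"
          using reals_Archimedean3[of "infdist z C"] by blast
        have "eventually (\<lambda>n. max 0 (1 - real n * infdist z C) = 0) sequentially"
          using eventually_ge_at_top[of N]
        proof eventually_elim
          case (elim n)
          then have "real N * infdist z C \<le> real n * infdist z C"
            by (intro mult_right_mono infdist_nonneg) auto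
          then show ?case using N by simp
        qed
        then show ?thesis using False by (simp add: tendsto_eventually)
      qed (use C in simp)
    qed
    show "AE z in \<nu>. norm (max 0 (1 - real n * infdist z C)) \<le> 1" for n
      by (intro AE_I2) (simp add: infdist_nonneg)
    have [measurable]: "(\<lambda>z. max 0 (1 - real n * infdist z C)) \<in> borel_measurable borel" for n
      by (intro borel_measurable_continuous_onI continuous_intros)
    show "(\<lambda>z. max 0 (1 - real n * infdist z C)) \<in> borel_measurable \<nu>" for n by measurable
    show "indicator C \<in> borel_measurable \<nu>" using C by (intro borel_measurable_indicator) auto
  qed auto
  then show ?thesis using C by simp
qed

theorem measure_eqI_moments:
  assumes \<mu>: "\<mu> \<in> prob_measures_on unit_circle" and \<nu>: "\<nu> \<in> prob_measures_on unit_circle"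
    and moments: "\<And>n. (LINT z|\<mu>. z ^ n) = (LINT z|\<nu>. z ^ n)"
  shows "\<mu> = \<nu>"
proof (rule measure_eqI_generator_eq[where E="Collect closed" and \<Omega>=UNIV and A="\<lambda>_. UNIV"])
  interpret \<mu>: prob_space \<mu> using prob_measures_onD[OF \<mu>] by auto
  interpret \<nu>: prob_space \<nu> using prob_measures_onD[OF \<nu>] by auto
  show "Int_stable (Collect closed)" by (auto simp: Int_stable_def)
  show "sets \<mu> = sigma_sets UNIV (Collect closed)" "sets \<nu> = sigma_sets UNIV (Collect closed)"
    using prob_measures_onD(2)[OF \<mu>] prob_measures_onD(2)[OF \<nu>] by (simp_all add: borel_eq_closed)
  fix C :: "complex set" assume C: "C \<in> Collect closed"
  show "emeasure \<mu> C = emeasure \<nu> C"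
  proof (cases "C = {}")
    case False
    have "(LINT z|\<mu>. max 0 (1 - real n * infdist z C)) = (LINT z|\<nu>. max 0 (1 - real n * infdist z C))" for n
      by (intro integral_eq_if_moments_eq[OF \<mu> \<nu> moments] continuous_intros)
    then have "measure \<mu> C = measure \<nu> C"
      using measure_closed_limit[OF \<mu> _ False] measure_closed_limit[OF \<nu> _ False] C
      by (auto intro: LIMSEQ_unique)
    then show ?thesis by (simp add: \<mu>.emeasure_eq_measure \<nu>.emeasure_eq_measure)
  qed simp
next
  show "emeasure \<mu> UNIV \<noteq> \<infinity>"
    using prob_space.emeasure_space_1[OF prob_measures_onD(1)[OF \<mu>]] prob_measures_onD(4)[OF \<mu>] by simp
qed auto

lemma measurable_cis_uniform: "cis \<in> measurable (uniform_measure lborel A) borel"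
proof -
  have "cis \<in> borel_measurable borel"
    by (intro borel_measurable_continuous_onI continuous_intros)
  then show ?thesis
    by (subst measurable_cong_sets[OF sets_uniform_measure refl]) simp
qed

section \<open>Arc length measure as equilibrium measure\<close>

lemma arc_measure_on_circle: "arc_measure \<in> prob_measures_on unit_circle"
proof (rule prob_measures_onI_AE)
  have "prob_space (uniform_measure lborel {0..2 * pi})"
    by (rule prob_space_uniform_measure) (auto simp: ennreal_eq_0_iff not_le)
  then interpret U: prob_space "uniform_measure lborel {0..2 * pi}" .
  note meas = measurable_cis_uniform[of "{0..2 * pi}"]
  show "prob_space arc_measure"
    unfolding arc_measure_def by (rule U.prob_space_distr[OF meas])
  show "AE z in arc_measure. z \<in> unit_circle"
    unfolding arc_measure_def by (subst AE_distr_iff[OF meas]) auto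
  show "sets arc_measure = sets borel" by (simp add: arc_measure_def)
qed simp

lemma arc_measure_moment:
  assumes "0 < n"
  shows "(LINT z|arc_measure. z ^ n) = 0"
proof -
  note meas = measurable_cis_uniform[of "{0..2 * pi}"]
  define g :: "real \<Rightarrow> real" where "g x = indicator {0..2 * pi} x / (2 * pi)" for x
  have uni: "uniform_measure lborel {0..2 * pi} = density lborel (\<lambda>x. ennreal (g x))"
    unfolding uniform_measure_def
    by (intro arg_cong2[of _ _ _ _ density] ext) (auto simp: g_def indicator_def divide_ennreal simp flip: ennreal_1)
  have "(LINT z|arc_measure. z ^ n) = (LINT x|uniform_measure lborel {0..2 * pi}. cis x ^ n)"
    unfolding arc_measure_def by (rule integral_distr[OF meas]) measurable
  also have "\<dots> = (LINT x|lborel. g x *\<^sub>R cis x ^ n)"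
    unfolding uni by (rule integral_density) (auto simp: g_def intro!: borel_measurable_continuous_onI continuous_intros)
  also have "\<dots> = (LINT x|lborel. (1 / (2 * pi)) *\<^sub>R (indicator {0..2 * pi} x *\<^sub>R cis (real n * x)))"
    by (simp add: g_def Complex.DeMoivre)
  also have "\<dots> = (1 / (2 * pi)) *\<^sub>R (LINT x|lborel. indicator {0..2 * pi} x *\<^sub>R cis (real n * x))"
    by (rule integral_scaleR_right)
  also have "(LINT x|lborel. indicator {0..2 * pi} x *\<^sub>R cis (real n * x))
     = cis (real n * (2 * pi)) / (\<i> * n) - cis (real n * 0) / (\<i> * n)"
  proof (rule integral_FTC_Icc)
    fix x :: real
    have "((\<lambda>x. exp (\<i> * (n * complex_of_real x)) / (\<i> * n)) has_vector_derivative exp (\<i> * (n * complex_of_real x))) (at x within {0..2 * pi})"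
      using assms by (auto intro!: derivative_eq_intros has_vector_derivative_real_field simp: field_simps)
    then show "((\<lambda>x. cis (real n * x) / (\<i> * n)) has_vector_derivative cis (real n * x)) (at x within {0..2 * pi})"
      by (simp add: cis_conv_exp)
  qed (auto intro!: continuous_intros)
  also have "cis (real n * (2 * pi)) = 1"
    by (metis Complex.DeMoivre cis_2pi power_one)
  finally show ?thesis by simp
qed

lemma log_energy_arc_measure: "log_energy arc_measure = 0"
proof (rule antisym)
  show "log_energy arc_measure \<le> 0"
    by (rule log_energy_le_0_if_moments_vanish[OF arc_measure_on_circle arc_measure_moment])
  show "0 \<le> log_energy arc_measure"
    using log_energy_ge_moment[OF arc_measure_on_circle, of 1] arc_measure_moment[of 1]
    by (simp add: zero_ereal_def)
qed

lemma robin_constant_unit_circle: "robin_constant unit_circle = 0"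
proof (rule antisym)
  show "robin_constant unit_circle \<le> 0"
    using robin_constant_le[OF arc_measure_on_circle] log_energy_arc_measure by simp
  show "0 \<le> robin_constant unit_circle"
    unfolding robin_constant_def
  proof (rule INF_greatest)
    fix \<nu> assume \<nu>: "\<nu> \<in> prob_measures_on unit_circle"
    have "0 \<le> ereal ((cmod (LINT w|\<nu>. w ^ 1))\<^sup>2 / real 1)" by simp
    also have "\<dots> \<le> log_energy \<nu>" by (rule log_energy_ge_moment[OF \<nu>]) simp
    finally show "0 \<le> log_energy \<nu>" .
  qed
qed

lemma capacity_unit_circle: "capacity unit_circle = 1"
  by (simp add: capacity_def robin_constant_unit_circle)

lemma is_equilibrium_measure_unit_circle_iff:
  "is_equilibrium_measure unit_circle \<mu> \<longleftrightarrow> \<mu> = arc_measure"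
proof
  assume "is_equilibrium_measure unit_circle \<mu>"
  then have \<mu>: "\<mu> \<in> prob_measures_on unit_circle" "log_energy \<mu> = 0"
    by (auto simp: is_equilibrium_measure_def robin_constant_unit_circle)
  interpret \<mu>: prob_space \<mu> using prob_measures_onD[OF \<mu>(1)] by auto
  interpret arc: prob_space arc_measure using prob_measures_onD[OF arc_measure_on_circle] by auto
  show "\<mu> = arc_measure"
  proof (rule measure_eqI_moments[OF \<mu>(1) arc_measure_on_circle])
    fix n
    show "(LINT z|\<mu>. z ^ n) = (LINT z|arc_measure. z ^ n)"
    proof (cases "n = 0")
      case False
      then have "(cmod (LINT w|\<mu>. w ^ n))\<^sup>2 / n \<le> 0"
        using log_energy_ge_moment[OF \<mu>(1), of n] \<mu>(2) by (simp add: zero_ereal_def)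
      then show ?thesis using False arc_measure_moment[of n] by (simp add: divide_le_0_iff)
    qed (simp add: \<mu>.prob_space arc.prob_space)
  qed
qed (simp add: is_equilibrium_measure_def arc_measure_on_circle log_energy_arc_measure robin_constant_unit_circle)

lemma widom_factor_arc_measure: "widom_factor n arc_measure = 1"
proof (rule antisym)
  have eq: "is_equilibrium_measure unit_circle arc_measure"
    by (simp add: is_equilibrium_measure_unit_circle_iff)
  have np: "non_polar unit_circle" by (simp add: non_polar_def capacity_unit_circle)
  interpret prob_space arc_measure using prob_measures_onD[OF arc_measure_on_circle] by auto
  show "1 \<le> widom_factor n arc_measure"
    by (rule widom_factor_ge_1[OF compact_sphere np eq])
  obtain V where atoms: "\<And>a. emeasure arc_measure {a} = 0"
    using frostman[OF eq compact_sphere np] by blast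
  have cap: "capacity (msupport arc_measure) = 1"
    using robin_constant_msupport[OF eq compact_sphere] by (simp add: capacity_def robin_constant_unit_circle)
  have "L2_poly_norm arc_measure (monic_orth_poly n arc_measure) \<le> L2_poly_norm arc_measure (monom 1 n)"
    by (rule monic_orth_poly(2)[OF arc_measure_on_circle compact_sphere atoms])
       (simp add: monic_polys_def degree_monom_eq)
  also have "(LINT z|arc_measure. (cmod (poly (monom 1 n) z))\<^sup>2) = (LINT z|arc_measure. 1)"
    using AE_unit_circle[OF arc_measure_on_circle] prob_measures_onD(2)[OF arc_measure_on_circle]
    by (intro integral_cong_AE) (auto simp: poly_monom norm_power elim!: eventually_mono)
  then have "L2_poly_norm arc_measure (monom 1 n) = 1"
    by (simp add: L2_poly_norm_def prob_space)
  finally show "widom_factor n arc_measure \<le> 1" by (simp add: widom_factor_def cap)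
qed

theorem corollary1p4:
  shows "(\<forall>K \<mu>. compact K \<longrightarrow> non_polar K \<longrightarrow> is_equilibrium_measure K \<mu> \<longrightarrow>
            (INF n. widom_factor n \<mu>) \<ge> 1)
       \<and> compact unit_circle \<and> non_polar unit_circle
       \<and> (\<forall>\<mu>. is_equilibrium_measure unit_circle \<mu> \<longleftrightarrow> \<mu> = arc_measure)
       \<and> (\<forall>n. widom_factor n arc_measure = 1)"
proof (intro conjI allI impI)
  fix K \<mu>
  assume "compact K" "non_polar K" "is_equilibrium_measure K \<mu>"
  then show "1 \<le> (INF n. widom_factor n \<mu>)"
    by (intro cINF_greatest widom_factor_ge_1) auto
next
  show "non_polar unit_circle"
    by (simp add: non_polar_def capacity_unit_circle)
qed (simp_all add: is_equilibrium_measure_unit_circle_iff widom_factor_arc_measure)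

end
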